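(* Let $n,k\geq 1$ be integers such that $\gcd(k,n)=1$. Then the bent function $\operatorname{Tr}_n\big(a x^{\frac{3^k+1}{2}}\big)$ (as a function of $x\in\mathbb{F}_{3^n}$ with values in $\mathbb{F}_3$), where $a\in\mathbb{F}_{3^n}^*$, is weakly regular bent.
   Context: $\mathbb{F}_{3^n}$ denotes the finite field with $3^n$ elements, $\mathbb{F}_{3^n}^*$ its set of nonzero elements, and $\operatorname{Tr}_n:\mathbb{F}_{3^n}\to\mathbb{F}_3$ the absolute trace. Let $\omega=e^{2\pi i/3}$; elements of $\mathbb{F}_3$ are regarded as integers modulo $3$ when used as exponents of $\omega$. For $f:\mathbb{F}_{3^n}\to\mathbb{F}_3$ and $b\in\mathbb{F}_{3^n}$, the Walsh coefficient of $f$ at $b$ is $S_f(b)=\sum_{x\in\mathbb{F}_{3^n}}\omega^{f(x)-\operatorname{Tr}_n(bx)}$. The function $f$ is (ternary) bent if $|S_f(b)|^2=3^n$ for all $b\in\mathbb{F}_{3^n}$. A bent function $f$ is weakly regular if there exist a complex number $u$ with $|u|=1$ and a function $f^*:\mathbb{F}_{3^n}\to\mathbb{F}_3$ such that $u\,3^{-n/2}S_f(b)=\omega^{f^*(b)}$ for all $b\in\mathbb{F}_{3^n}$. The functions $\operatorname{Tr}_n\big(a x^{\frac{3^k+1}{2}}\big)$ with $\gcd(k,n)=1$ and $a\neq 0$ are called the Coulter-Matthews bent functions.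
   Formalization: For even k the function is never bent (e.g. n=1, k=2, a=1 gives the linear function x), so the claim fails there; the formal theorem proves bentness for odd k, and weak regularity whenever the function is bent. *)

theory Defs
  imports Complex_Main "HOL-Library.Cardinality"
begin

text \<open>The field with \<open>3 ^ n\<close> elements is an arbitrary type \<open>'a :: {field, finite}\<close> with
  \<open>CARD('a) = 3 ^ n\<close>, and the field with three elements is its prime subfield. A function from
  the former to the latter is a function of type \<open>'a \<Rightarrow> 'a\<close> with all its values in \<open>F3\<close>.\<close>

definition F3 :: "'a :: field set" where
  "F3 = range of_int"

definition Tr :: "nat \<Rightarrow> 'a :: field \<Rightarrow> 'a" where
  "Tr n x = (\<Sum>i<n. x ^ (3 ^ i))"

definition \<omega> :: complex where
  "\<omega> = exp (2 * of_real pi * \<i> / 3)"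

text \<open>The power \<open>\<omega> ^ t\<close> for \<open>t\<close> in \<open>F3\<close>: in characteristic 3 the least natural number
  representing \<open>t\<close> is 0, 1 or 2. The value is meaningless for \<open>t\<close> outside \<open>F3\<close>.\<close>

definition omega_pow :: "'a :: field \<Rightarrow> complex" where
  "omega_pow t = \<omega> ^ (LEAST j. of_nat j = t)"

definition walsh :: "nat \<Rightarrow> ('a \<Rightarrow> 'a) \<Rightarrow> 'a :: {field, finite} \<Rightarrow> complex" where
  "walsh n f b = (\<Sum>x\<in>UNIV. omega_pow (f x - Tr n (b * x)))"

definition bent :: "nat \<Rightarrow> ('a :: {field, finite} \<Rightarrow> 'a) \<Rightarrow> bool" where
  "bent n f \<longleftrightarrow> (\<forall>x. f x \<in> F3) \<and> (\<forall>b. (cmod (walsh n f b))\<^sup>2 = 3 ^ n)"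

definition weakly_regular_bent :: "nat \<Rightarrow> ('a :: {field, finite} \<Rightarrow> 'a) \<Rightarrow> bool" where
  "weakly_regular_bent n f \<longleftrightarrow> bent n f \<and>
    (\<exists>u f'. cmod u = 1 \<and> (\<forall>b. f' b \<in> F3) \<and>
      (\<forall>b. u * of_real (3 powr (- real n / 2)) * walsh n f b = omega_pow (f' b :: 'a)))"

definition coulter_matthews :: "nat \<Rightarrow> nat \<Rightarrow> 'a :: field \<Rightarrow> 'a \<Rightarrow> 'a" where
  "coulter_matthews n k a x = Tr n (a * x ^ ((3 ^ k + 1) div 2))"

end

theory Submission
  imports Defs "Jordan_Normal_Form.Determinant" "HOL-Computational_Algebra.Polynomial"
begin

text \<open>For odd \<open>k\<close>, splitting \<open>x\<close> into squares \<open>y\<^sup>2\<close> and non-squares \<open>g y\<^sup>2\<close> turns twice the Walsh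
  coefficient at \<open>b\<close> into a sum of two Gauss sums of quadratic forms over \<open>F3\<close>, namely of
  \<open>Tr (a y\<^bsup>3^k+1\<^esup> - b y\<^sup>2)\<close> and of the same form for \<open>a g\<^bsup>(3^k+1)/2\<^esup>\<close> and \<open>b g\<close>. In terms of the
  conjugates \<open>y\<^bsup>3^(ks)\<^esup>\<close> the first form has a periodic Jacobi matrix; the matrix of the second is
  congruent, up to a factor of norm \<open>- 1\<close>, to the one with the sign of the two corner entries
  reversed. The determinants of these two periodic matrices differ by a constant which does not
  depend on \<open>b\<close>. So the discriminants of the two forms add up to a constant \<open>e = \<plusminus>1\<close> of \<open>F3\<close>, which
  leaves the pairs \<open>(- e, - e)\<close>, \<open>(0, e)\<close>, \<open>(e, 0)\<close>. With \<open>G = \<i> \<surd>3\<close>, in each case the Walsh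
  coefficient is \<open>\<epsilon> G\<^sup>n w\<close> with a fixed sign \<open>\<epsilon>\<close>, where \<open>w\<close> is a cube root of unity or has
  modulus above 1; Parseval's identity excludes the latter.
  For even \<open>k\<close> the number \<open>n\<close> is odd and \<open>x\<^bsup>(3^k+1)/2\<^esup>\<close> permutes the field, so that the Walsh
  coefficient at 0 vanishes and the function is not bent.\<close>

section \<open>Periodic Jacobi matrices\<close>

text \<open>Laplace expansion along row \<open>i\<close>: the cofactors of that row do not involve
  it, so the determinant is affine in the entry.\<close>

lemma det_add_entry:
  fixes A B :: "'b :: comm_ring_1 mat"
  assumes A: "A \<in> carrier_mat n n" and B: "B \<in> carrier_mat n n" and i: "i < n" and j: "j < n"
    and ij: "B $$ (i, j) = A $$ (i, j) + x"
    and eq: "\<And>r s. r < n \<Longrightarrow> s < n \<Longrightarrow> (r, s) \<noteq> (i, j) \<Longrightarrow> B $$ (r, s) = A $$ (r, s)"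
  shows "det B = det A + x * cofactor A i j"
proof -
  have del: "mat_delete B i s = mat_delete A i s" if "s < n" for s
    using A B i that by (intro eq_matI) (auto simp: mat_delete_def eq)
  have "det B = (\<Sum>s<n. B $$ (i, s) * cofactor B i s)"
    by (rule laplace_expansion_row[OF B i])
  also have "\<dots> = (\<Sum>s<n. A $$ (i, s) * cofactor A i s + (if s = j then x * cofactor A i j else 0))"
    using i j by (intro sum.cong refl) (auto simp: cofactor_def del ij eq algebra_simps)
  also have "\<dots> = det A + x * cofactor A i j"
    unfolding sum.distrib laplace_expansion_row[OF A i] using j by simp
  finally show ?thesis .
qed

text \<open>Each Leibniz product meets every row and every column once and so collects all factors
  \<open>c s\<close> and \<open>d t\<close>.\<close>

lemma det_scale:
  fixes A B :: "'b :: comm_ring_1 mat"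
  assumes A: "A \<in> carrier_mat n n" and B: "B \<in> carrier_mat n n"
    and eq: "\<And>s t. s < n \<Longrightarrow> t < n \<Longrightarrow> B $$ (s, t) = c s * d t * A $$ (s, t)"
  shows "det B = (\<Prod>s<n. c s) * (\<Prod>s<n. d s) * det A"
proof -
  have "signof p * (\<Prod>i = 0..<n. B $$ (i, p i)) =
      (\<Prod>s<n. c s) * (\<Prod>s<n. d s) * (signof p * (\<Prod>i = 0..<n. A $$ (i, p i)))"
    if p: "p permutes {0..<n}" for p
  proof -
    have lt: "p i < n" if "i < n" for i
      using permutes_in_image[OF p, of i] that by simp
    have "(\<Prod>i = 0..<n. B $$ (i, p i)) = (\<Prod>i = 0..<n. c i * d (p i) * A $$ (i, p i))"
      by (intro prod.cong refl eq) (auto simp: lt)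
    also have "\<dots> = (\<Prod>i = 0..<n. c i) * (\<Prod>i = 0..<n. d (p i)) * (\<Prod>i = 0..<n. A $$ (i, p i))"
      by (simp add: prod.distrib)
    also have "(\<Prod>i = 0..<n. d (p i)) = (\<Prod>i = 0..<n. d i)"
      using prod.permute[OF p, of d] by (simp add: comp_def)
    finally show ?thesis by (simp add: lessThan_atLeast0 algebra_simps)
  qed
  then show ?thesis
    by (simp add: det_def'[OF A] det_def'[OF B] sum_distrib_left)
qed

text \<open>The entries are summed up since for \<open>n \<le> 2\<close> the corners \<open>u\<close> and \<open>v\<close> fall onto the
  tridiagonal part.\<close>

definition jacobi_mat :: "nat \<Rightarrow> (nat \<Rightarrow> 'b) \<Rightarrow> (nat \<Rightarrow> 'b) \<Rightarrow> 'b \<Rightarrow> 'b \<Rightarrow> 'b :: comm_ring_1 mat" where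
  "jacobi_mat n d c u v = mat n n (\<lambda>(s, t).
    (if s = t then d s else 0) + (if t = Suc s then c s else 0) + (if s = Suc t then c t else 0) +
    (if s = 0 \<and> t = n - 1 then u else 0) + (if s = n - 1 \<and> t = 0 then v else 0))"

lemma jacobi_mat_carrier [simp]: "jacobi_mat n d c u v \<in> carrier_mat n n"
  by (simp add: jacobi_mat_def)

text \<open>The determinant with corners \<open>u\<close> and \<open>v\<close> is a constant, plus
  \<open>(-1) ^ (n - 1) * (u + v)\<close> times the product of the \<open>c s\<close>, plus a
  multiple of \<open>u * v\<close>. Reversing both signs changes the middle term only, and the
  diagonal \<open>d\<close> enters just what cancels.\<close>

lemma det_jacobi_mat_corner:
  fixes d c :: "nat \<Rightarrow> 'b :: comm_ring_1"
  assumes "n > 0"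
  shows "det (jacobi_mat n d c u u) - det (jacobi_mat n d c (- u) (- u)) =
    4 * (-1) ^ (n - 1) * (u * (\<Prod>s<n - 1. c s))"
proof -
  obtain m where n: "n = Suc m" using assms by (cases n) auto
  define P where "P = (\<Prod>s<m. c s)"
  \<comment> \<open>The minor at the lower left corner. For \<open>u = 0\<close> it is lower
    triangular with diagonal entries \<open>c s\<close>; \<open>u\<close> itself is added in its
    upper right corner.\<close>
  define N where "N u = mat_delete (jacobi_mat n d c u 0) m 0" for u
  have N: "N u \<in> carrier_mat m m" for u
    using mat_delete_carrier[OF jacobi_mat_carrier, of n d c u 0 m 0] by (simp add: N_def n)
  have N_entry: "N u $$ (i, j) = jacobi_mat n d c u 0 $$ (i, Suc j)" if "i < m" "j < m" for u i j
    using that by (simp add: N_def mat_delete_def n jacobi_mat_def)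
  have "\<exists>w. \<forall>u. det (N u) = P + u * w"
  proof (cases m)
    case 0
    then have "det (N u) = P" for u using N[of u] by (simp add: P_def)
    then show ?thesis by (intro exI[of _ 0]) simp
  next
    case (Suc l)
    have "det (N 0) = prod_list (diag_mat (N 0))"
      by (rule det_lower_triangular[OF _ N]) (use Suc n in \<open>auto simp: N_entry jacobi_mat_def\<close>)
    also have "\<dots> = (\<Prod>i = 0..<m. N 0 $$ (i, i))"
      using N[of 0] by (simp add: prod_list_diag_prod)
    also have "\<dots> = P"
      unfolding P_def by (intro prod.cong) (auto simp: N_entry jacobi_mat_def n)
    finally have N0: "det (N 0) = P" .
    have "det (N u) = det (N 0) + u * cofactor (N 0) 0 l" for u
      by (rule det_add_entry[OF N N]) (use Suc in \<open>auto simp: N_entry jacobi_mat_def n\<close>)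
    then show ?thesis by (auto simp: N0)
  qed
  then obtain w where w: "\<And>u. det (N u) = P + u * w" by auto
  have step: "det (jacobi_mat n d c u v) = det (jacobi_mat n d c u 0) + v * ((-1) ^ m * (P + u * w))" for u v
  proof -
    have "det (jacobi_mat n d c u v) = det (jacobi_mat n d c u 0) + v * cofactor (jacobi_mat n d c u 0) m 0"
      by (rule det_add_entry[where n = n]) (auto simp: jacobi_mat_def n)
    then show ?thesis by (simp add: cofactor_def w flip: N_def)
  qed
  \<comment> \<open>Transposition swaps the corners, so \<open>step\<close> also gives the
    dependence on \<open>u\<close> when \<open>v = 0\<close>.\<close>
  have "(jacobi_mat n d c u v)\<^sup>T = jacobi_mat n d c v u" for u v
    by (intro eq_matI) (auto simp: jacobi_mat_def)
  then have sym: "det (jacobi_mat n d c u v) = det (jacobi_mat n d c v u)" for u v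
    using det_transpose[OF jacobi_mat_carrier[of n d c u v]] by simp
  have "det (jacobi_mat n d c u v) =
      det (jacobi_mat n d c 0 0) + u * ((-1) ^ m * P) + v * ((-1) ^ m * (P + u * w))" for u v
    unfolding step[of u v] sym[of u 0] step[of 0 u] by simp
  from this[of u u] this[of "- u" "- u"] show ?thesis
    by (simp add: n flip: P_def) (simp add: algebra_simps)
qed

text \<open>With both corners equal to \<open>c (n - 1)\<close> the matrix couples the indices
  cyclically; periodicity of \<open>x\<close> and \<open>y\<close> turns the corner terms into the
  mixed terms at \<open>s = n - 1\<close>.\<close>

lemma jacobi_mat_form:
  fixes d c x y :: "nat \<Rightarrow> 'b :: comm_ring_1"
  assumes "n > 0" and "x n = x 0" and "y n = y 0"
  shows "(\<Sum>s<n. \<Sum>t<n. jacobi_mat n d c (c (n - 1)) (c (n - 1)) $$ (s, t) * x s * y t) =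
    (\<Sum>s<n. d s * x s * y s + c s * (x s * y (Suc s) + x (Suc s) * y s))"
proof -
  obtain m where n: "n = Suc m" using assms by (cases n) auto
  \<comment> \<open>At the last index \<open>Suc t = n\<close> is out of range, so the sum stops
    before \<open>m\<close>; the term lost there returns through the corners.\<close>
  have shift: "(\<Sum>t<n. \<Sum>s<n. if s = Suc t then F t else 0) = (\<Sum>t<m. F t)" for F :: "nat \<Rightarrow> 'b"
  proof -
    have "(\<Sum>t<n. \<Sum>s<n. if s = Suc t then F t else 0) = (\<Sum>t<n. if Suc t < n then F t else 0)"
      by (intro sum.cong refl) (simp add: sum.delta)
    also have "\<dots> = (\<Sum>t<m. F t)" by (simp add: n)
    finally show ?thesis .
  qed
  have "(\<Sum>s<n. \<Sum>t<n. jacobi_mat n d c (c (n - 1)) (c (n - 1)) $$ (s, t) * x s * y t) =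
     (\<Sum>s<n. \<Sum>t<n. (if s = t then d s * x s * y s else 0) +
        (if t = Suc s then c s * x s * y (Suc s) else 0) +
        (if s = Suc t then c t * x (Suc t) * y t else 0) +
        (if s = 0 then if t = m then c m * x 0 * y m else 0 else 0) +
        (if t = 0 then if s = m then c m * x m * y 0 else 0 else 0))"
    by (intro sum.cong refl) (simp add: jacobi_mat_def n algebra_simps)
  also have "\<dots> = (\<Sum>s<n. d s * x s * y s) +
      (\<Sum>s<n. \<Sum>t<n. if t = Suc s then c s * x s * y (Suc s) else 0) +
      (\<Sum>s<n. \<Sum>t<n. if s = Suc t then c t * x (Suc t) * y t else 0) +
      c m * x 0 * y m + c m * x m * y 0"
    by (simp add: sum.distrib n cong: if_cong)
  also have "(\<Sum>s<n. \<Sum>t<n. if s = Suc t then c t * x (Suc t) * y t else 0) =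
      (\<Sum>t<n. \<Sum>s<n. if s = Suc t then c t * x (Suc t) * y t else 0)"
    by (rule sum.swap)
  also have "\<dots> = (\<Sum>t<m. c t * x (Suc t) * y t)"
    by (rule shift)
  also have "(\<Sum>s<n. \<Sum>t<n. if t = Suc s then c s * x s * y (Suc s) else 0) =
     (\<Sum>t<m. c t * x t * y (Suc t))"
    by (rule shift)
  finally show ?thesis using assms(2,3)
    by (simp add: n sum.distrib algebra_simps)
qed

section \<open>The field with \<open>3 ^ n\<close> elements\<close>

lemma omega_eq: "\<omega> = Complex (-1/2) (sqrt 3 / 2)"
proof -
  have "\<omega> = cis (2 * pi / 3)"
    by (simp add: \<omega>_def cis_conv_exp mult.commute)
  also have "\<dots> = Complex (-1/2) (sqrt 3 / 2)"
    by (simp add: complex_eq_iff cos_120 sin_120)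
  finally show ?thesis .
qed

lemma omega_square: "\<omega>\<^sup>2 = - 1 - \<omega>"
  by (simp add: omega_eq complex_eq_iff power2_eq_square)

lemma omega_cube: "\<omega> ^ 3 = 1"
proof -
  have "\<omega> ^ 3 = \<omega> * \<omega>\<^sup>2" by (simp add: power3_eq_cube power2_eq_square)
  also have "\<dots> = - \<omega> - \<omega>\<^sup>2" by (subst omega_square) (simp add: right_diff_distrib power2_eq_square)
  finally show ?thesis by (simp add: omega_square)
qed

lemma omega_ne_1: "\<omega> \<noteq> 1"
  by (simp add: omega_eq complex_eq_iff)

lemma omega_square_ne_1: "\<omega>\<^sup>2 \<noteq> 1"
  unfolding omega_square by (simp add: omega_eq complex_eq_iff)

text \<open>The quadratic Gauss sum of the field with three elements,
  \<open>\<omega> - \<omega>\<^sup>2\<close>.\<close>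

definition G :: complex where "G = \<i> * of_real (sqrt 3)"

lemma G_square: "G * G = - 3"
  by (simp add: G_def complex_eq_iff)

lemma omega_G: "\<omega> = (- 1 + G) / 2" "\<omega>\<^sup>2 = (- 1 - G) / 2"
  unfolding omega_square by (simp_all add: omega_eq G_def complex_eq_iff)

lemma norm_omega: "cmod \<omega> = 1"
  by (simp add: \<omega>_def)

lemma norm_omega_pow: "cmod (omega_pow x) = 1"
  by (simp add: omega_pow_def norm_power norm_omega)

lemma power3_add: "(x + y :: 'b :: comm_ring_1) ^ 3 = x ^ 3 + y ^ 3 + 3 * (x\<^sup>2 * y + x * y\<^sup>2)"
  by (simp add: power3_eq_cube power2_eq_square algebra_simps)

text \<open>These are the possible \<open>w\<close> when one of the two forms is degenerate:
  \<open>r = 1\<close> gives the primitive cube roots of unity, \<open>r = 2\<close> gives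
  \<open>1\<close> or \<open>- 2\<close>, and from \<open>r = 3\<close> on the modulus exceeds 1 by
  the triangle inequality.\<close>

lemma G_power_value:
  assumes "r \<ge> 1" and "\<delta> = 1 \<or> \<delta> = - 1"
  shows "(- 1 + \<delta> * G ^ r) / 2 \<in> {1, \<omega>, \<omega>\<^sup>2} \<or> cmod ((- 1 + \<delta> * G ^ r) / 2) > 1"
proof -
  consider "r = 1" | "r = 2" | "r \<ge> 3" using assms(1) by linarith
  then show ?thesis
  proof cases
    case 1
    then have "(- 1 + \<delta> * G ^ r) / 2 = \<omega> \<or> (- 1 + \<delta> * G ^ r) / 2 = \<omega>\<^sup>2"
      unfolding omega_G(2) unfolding omega_G(1) using assms(2) by auto
    then show ?thesis by blast
  next
    case 2
    then have "(- 1 + \<delta> * G ^ r) / 2 = (- 1 - 3 * \<delta>) / 2"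
      by (simp add: power2_eq_square G_square)
    then show ?thesis using assms(2) by auto
  next
    case 3
    have "sqrt 3 > 1" by simp
    then have "sqrt 3 ^ 3 \<le> sqrt 3 ^ r" using 3 by (intro power_increasing) auto
    moreover have "sqrt 3 ^ 3 = 3 * sqrt 3" by (simp add: power3_eq_cube)
    moreover have "cmod (\<delta> * G ^ r) = sqrt 3 ^ r"
      using assms(2) by (auto simp: norm_mult norm_power G_def)
    ultimately have "cmod (\<delta> * G ^ r) > 3" using \<open>sqrt 3 > 1\<close> by linarith
    moreover have "cmod (- 1 + \<delta> * G ^ r) \<ge> cmod (\<delta> * G ^ r) - cmod (- 1)"
      using norm_diff_ineq[of "\<delta> * G ^ r" "- 1"] by (simp add: add.commute)
    ultimately have "cmod (- 1 + \<delta> * G ^ r) > 2" by simp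
    then show ?thesis by (simp add: norm_divide)
  qed
qed


section \<open>Characteristic 3 and the prime field\<close>

locale ternary_field =
  fixes n k :: nat and ty :: "'a :: {field, finite} itself"
  assumes card_eq: "CARD('a) = 3 ^ n" and n_pos: "n > 0" and coprime: "gcd k n = 1"
begin

text \<open>The shift by 1 permutes the field, so summing all elements shows that their number
  \<open>3 ^ n\<close> vanishes in the field.\<close>

lemma three_eq_0 [simp]: "(3 :: 'a) = 0"
proof -
  have "(\<Sum>x\<in>UNIV. x) = (\<Sum>x\<in>UNIV. x + 1 :: 'a)"
    by (rule sum.reindex_bij_witness[of _ "\<lambda>x. x + 1" "\<lambda>x. x - 1"]) auto
  also have "\<dots> = (\<Sum>x\<in>UNIV. x) + of_nat CARD('a)"
    by (simp add: sum.distrib)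
  finally have "(3 :: 'a) ^ n = 0" by (simp add: card_eq)
  then show ?thesis by simp
qed

lemma two_eq [simp]: "(2 :: 'a) = - 1"
proof -
  have "(2 :: 'a) = 3 - 1" by simp
  then show ?thesis by (simp del: diff_numeral_special)
qed

lemma neg_one_ne_one: "(- 1 :: 'a) \<noteq> 1" "(1 :: 'a) \<noteq> - 1"
proof -
  show "(- 1 :: 'a) \<noteq> 1"
  proof
    assume "(- 1 :: 'a) = 1"
    then have "(2 :: 'a) = 1" by simp
    then have "(2 :: 'a) - 1 = 0" by (metis diff_self)
    then show False by simp
  qed
  then show "(1 :: 'a) \<noteq> - 1" by metis
qed

lemma cube_add: "(x + y) ^ 3 = x ^ 3 + (y :: 'a) ^ 3"
proof -
  have "(x + y) ^ 3 = x ^ 3 + y ^ 3 + 3 * (x\<^sup>2 * y + x * y\<^sup>2)"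
    by (rule power3_add)
  then show ?thesis by simp
qed

lemma pow3_add: "(x + y) ^ (3 ^ i) = x ^ (3 ^ i) + (y :: 'a) ^ (3 ^ i)"
  by (induction i) (simp_all add: power_mult mult.commute[of 3] cube_add)

lemma pow3_sum: "(\<Sum>i\<in>A. f i) ^ (3 ^ j) = (\<Sum>i\<in>A. f i ^ (3 ^ j) :: 'a)"
  by (induction A rule: infinite_finite_induct) (simp_all add: pow3_add zero_power)

lemma cube_eq_iff: "(x :: 'a) ^ 3 = x \<longleftrightarrow> x = 0 \<or> x = 1 \<or> x = - 1"
proof
  assume "x ^ 3 = x"
  then have "x * ((x - 1) * (x + 1)) = 0"
    by (simp add: power3_eq_cube algebra_simps)
  then show "x = 0 \<or> x = 1 \<or> x = - 1"
    by (auto simp: eq_neg_iff_add_eq_0)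
qed auto

lemma F3_eq: "(F3 :: 'a set) = {0, 1, - 1}"
proof
  show "(F3 :: 'a set) \<subseteq> {0, 1, - 1}"
  proof
    fix x :: 'a assume "x \<in> F3"
    then obtain i where x: "x = of_int i" by (auto simp: F3_def)
    have "i = 3 * (i div 3) + i mod 3" by simp
    then have "x = of_int (3 * (i div 3) + i mod 3)" using x by metis
    then have "x = of_int (i mod 3)"
      unfolding of_int_add of_int_mult by simp
    moreover have "i mod 3 = 0 \<or> i mod 3 = 1 \<or> i mod 3 = 2" by presburger
    ultimately show "x \<in> {0, 1, - 1}" by auto
  qed
  have "0 = (of_int 0 :: 'a)" "1 = (of_int 1 :: 'a)" "- 1 = (of_int (- 1) :: 'a)" by simp_all
  then show "{0, 1, - 1} \<subseteq> (F3 :: 'a set)" unfolding F3_def by blast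
qed

text \<open>The prime field as the fixed field of Frobenius; closure under the field operations
  follows at once.\<close>

lemma F3_iff: "x \<in> F3 \<longleftrightarrow> (x :: 'a) ^ 3 = x"
  by (simp add: F3_eq cube_eq_iff)

lemma F3_cases: "(x :: 'a) \<in> F3 \<Longrightarrow> (x = 0 \<Longrightarrow> P) \<Longrightarrow> (x = 1 \<Longrightarrow> P) \<Longrightarrow> (x = - 1 \<Longrightarrow> P) \<Longrightarrow> P"
  by (auto simp: F3_eq)

lemma F3_simps [simp, intro]: "(0 :: 'a) \<in> F3" "(1 :: 'a) \<in> F3" "(- 1 :: 'a) \<in> F3"
  by (simp_all add: F3_eq)

lemma F3_add: "x \<in> F3 \<Longrightarrow> y \<in> F3 \<Longrightarrow> x + y \<in> (F3 :: 'a set)"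
  by (simp add: F3_iff cube_add)

lemma F3_mult: "x \<in> F3 \<Longrightarrow> y \<in> F3 \<Longrightarrow> x * y \<in> (F3 :: 'a set)"
  by (simp add: F3_iff power_mult_distrib)

lemma F3_uminus: "x \<in> F3 \<Longrightarrow> - x \<in> (F3 :: 'a set)"
  by (auto simp: F3_eq)

lemma F3_diff: "x \<in> F3 \<Longrightarrow> y \<in> F3 \<Longrightarrow> x - y \<in> (F3 :: 'a set)"
  using F3_add[of x "- y"] F3_uminus[of y] by simp

lemma F3_divide: "x \<in> F3 \<Longrightarrow> y \<in> F3 \<Longrightarrow> x / y \<in> (F3 :: 'a set)"
  by (auto simp: F3_eq)

lemma F3_sum: "(\<And>i. i \<in> A \<Longrightarrow> f i \<in> F3) \<Longrightarrow> (\<Sum>i\<in>A. f i) \<in> (F3 :: 'a set)"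
  by (induction A rule: infinite_finite_induct) (auto intro: F3_add)

lemma F3_prod: "(\<And>i. i \<in> A \<Longrightarrow> f i \<in> F3) \<Longrightarrow> (\<Prod>i\<in>A. f i) \<in> (F3 :: 'a set)"
  by (induction A rule: infinite_finite_induct) (auto intro: F3_mult)

lemma F3_pow3: "x \<in> F3 \<Longrightarrow> (x :: 'a) ^ (3 ^ i) = x"
  by (induction i) (simp_all add: power_mult mult.commute[of 3] F3_iff)

lemma F3_square: "x \<in> F3 \<Longrightarrow> x \<noteq> 0 \<Longrightarrow> (x :: 'a)\<^sup>2 = 1"
  by (auto simp: F3_eq)

section \<open>The additive character of the prime field\<close>

abbreviation chi :: "'a \<Rightarrow> complex" where "chi \<equiv> omega_pow"

lemma chi_0 [simp]: "chi 0 = 1"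
proof -
  have "(LEAST j. of_nat j = (0 :: 'a)) = 0" by (rule Least_equality) auto
  then show ?thesis by (simp add: omega_pow_def)
qed

lemma chi_1: "chi 1 = \<omega>"
proof -
  have "(LEAST j. of_nat j = (1 :: 'a)) = 1"
  proof (rule Least_equality)
    show "1 \<le> j" if "of_nat j = (1 :: 'a)" for j
      using that by (cases j) auto
  qed simp
  then show ?thesis by (simp add: omega_pow_def)
qed

lemma chi_neg_1: "chi (- 1) = \<omega>\<^sup>2"
proof -
  have "(LEAST j. of_nat j = (- 1 :: 'a)) = 2"
  proof (rule Least_equality)
    show "2 \<le> j" if j: "of_nat j = (- 1 :: 'a)" for j
    proof (rule ccontr)
      assume "\<not> 2 \<le> j"
      then have "j = 0 \<or> j = 1" by auto
      then show False using j neg_one_ne_one by auto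
    qed
  qed simp
  then show ?thesis by (simp add: omega_pow_def)
qed

lemma chi_add:
  assumes "x \<in> F3" and "y \<in> F3"
  shows "chi (x + y) = chi x * chi y"
proof -
  have "\<omega> * \<omega>\<^sup>2 = 1" "\<omega>\<^sup>2 * \<omega> = 1" "\<omega>\<^sup>2 * \<omega>\<^sup>2 = \<omega>"
    using omega_cube by (auto simp: power2_eq_square power3_eq_cube mult.assoc)
  then show ?thesis
    using assms by (elim F3_cases) (simp_all add: chi_1 chi_neg_1 power2_eq_square)
qed

lemma chi_ne_1: "x \<in> F3 \<Longrightarrow> x \<noteq> 0 \<Longrightarrow> chi x \<noteq> 1"
  by (auto elim!: F3_cases simp: chi_1 chi_neg_1 omega_ne_1 omega_square_ne_1)

lemma chi_diff: "x \<in> F3 \<Longrightarrow> y \<in> F3 \<Longrightarrow> chi (x - y) = chi x * cnj (chi y)"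
proof -
  assume "x \<in> F3" "y \<in> F3"
  then have "chi (x - y) * chi y = chi x"
    using chi_add[of "x - y" y] by (simp add: F3_diff)
  moreover have "chi y * cnj (chi y) = 1"
    by (simp add: complex_norm_square[symmetric] norm_omega_pow)
  ultimately show ?thesis by (metis mult.assoc mult.right_neutral)
qed

section \<open>Frobenius powers, conjugates and the norm\<close>

lemma power_card: "(x :: 'a) ^ (3 ^ n) = x"
proof (cases "x = 0")
  case False
  define P where "P = (\<Prod>y\<in>UNIV - {0 :: 'a}. y)"
  \<comment> \<open>Multiplication by \<open>x\<close> permutes the nonzero elements.\<close>
  have "P = (\<Prod>y\<in>UNIV - {0}. x * y)"
    unfolding P_def using False
    by (intro prod.reindex_bij_witness[of _ "\<lambda>y. x * y" "\<lambda>y. y / x"]) auto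
  also have "\<dots> = x ^ (3 ^ n - 1) * P"
    by (simp add: prod.distrib P_def card_Diff_singleton card_eq)
  finally have "x ^ (3 ^ n - 1) = 1" by (simp add: P_def)
  then have "x * x ^ (3 ^ n - 1) = x" by simp
  then show ?thesis by (simp flip: power_Suc)
qed (simp add: zero_power)

lemma power_card_minus_1: "(x :: 'a) \<noteq> 0 \<Longrightarrow> x ^ (3 ^ n - 1) = 1"
  using power_card[of x] power_minus_mult[of "3 ^ n" x] by simp

lemma pow3_mod: "(x :: 'a) ^ (3 ^ j) = x ^ (3 ^ (j mod n))"
proof -
  have *: "x ^ (3 ^ (n * q)) = x" for q
  proof (induction q)
    case (Suc q)
    have "x ^ (3 ^ (n * Suc q)) = (x ^ (3 ^ n)) ^ (3 ^ (n * q))"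
      by (simp add: power_add flip: power_mult)
    then show ?case by (simp add: power_card Suc)
  qed simp
  have "x ^ (3 ^ j) = x ^ (3 ^ (n * (j div n) + j mod n))" by simp
  also have "\<dots> = (x ^ (3 ^ (n * (j div n)))) ^ (3 ^ (j mod n))"
    by (simp only: power_add power_mult)
  finally show ?thesis by (simp add: *)
qed

text \<open>Powers of the automorphism sending \<open>x\<close> to \<open>x ^ (3 ^ k)\<close>. As
  \<open>k\<close> is prime to \<open>n\<close>, it generates the Galois group; in this order of the
  conjugates the exponent \<open>3 ^ k + 1\<close> couples only neighbours.\<close>

definition fr :: "nat \<Rightarrow> 'a \<Rightarrow> 'a" where "fr s x = x ^ (3 ^ (k * s))"

lemma fr_0 [simp]: "fr 0 x = x" and fr_n [simp]: "fr n x = x"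
  by (simp_all add: fr_def pow3_mod[of x "k * n"])

lemma fr_at_0 [simp]: "fr s 0 = 0"
  by (simp add: fr_def zero_power)

lemma fr_Suc: "fr (Suc s) x = fr s (x ^ (3 ^ k))"
  by (simp add: fr_def power_add flip: power_mult)

lemma fr_add: "fr s (x + y) = fr s x + fr s y"
  by (simp add: fr_def pow3_add)

lemma fr_sum: "fr s (\<Sum>i\<in>A. f i) = (\<Sum>i\<in>A. fr s (f i))"
  by (simp add: fr_def pow3_sum)

lemma fr_mult: "fr s (x * y) = fr s x * fr s y"
  by (simp add: fr_def power_mult_distrib)

lemma fr_uminus: "fr s (- x) = - fr s x"
  using fr_add[of s x "- x"] by (simp add: eq_neg_iff_add_eq_0 add.commute)

lemma fr_F3: "c \<in> F3 \<Longrightarrow> fr s c = c"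
  by (simp add: fr_def F3_pow3)

text \<open>Makes the list of conjugates by \<open>fr\<close> a reordering of the usual one, so that
  sums and products over it are trace and norm.\<close>

lemma bij_betw_mult_mod: "bij_betw (\<lambda>s. k * s mod n) {..<n} {..<n}"
proof -
  have le: "s = t" if "k * s mod n = k * t mod n" "s < n" "t < n" "s \<le> t" for s t
  proof -
    have "n dvd k * t - k * s"
      using that by (metis mod_eq_dvd_iff_nat mult_le_mono2)
    then have "n dvd k * (t - s)" by (simp add: diff_mult_distrib2)
    then have "n dvd t - s" using coprime
      by (metis coprime_dvd_mult_right_iff coprime_iff_gcd_eq_1 gcd.commute)
    then have "t - s = 0" using that by (metis dvd_imp_le less_imp_diff_less linorder_not_less neq0_conv)
    then show ?thesis using that by simp
  qed
  have "inj_on (\<lambda>s. k * s mod n) {..<n}"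
    by (rule inj_onI) (metis le lessThan_iff nat_le_linear)
  moreover have "(\<lambda>s. k * s mod n) ` {..<n} \<subseteq> {..<n}" using n_pos by auto
  ultimately show ?thesis
    by (simp add: bij_betw_def endo_inj_surj)
qed

lemma sum_fr: "(\<Sum>s<n. fr s x) = Tr n x"
proof -
  have "(\<Sum>s<n. fr s x) = (\<Sum>s<n. x ^ (3 ^ (k * s mod n)))"
    by (simp add: fr_def flip: pow3_mod)
  also have "\<dots> = Tr n x"
    unfolding Tr_def by (rule sum.reindex_bij_betw[OF bij_betw_mult_mod])
  finally show ?thesis .
qed

lemma sum_pow3_eq: "(\<Sum>i<m. 3 ^ i) = (3 ^ m - 1) div (2 :: nat)"
  by (induction m) auto

text \<open>The norm to \<open>F3\<close>: its exponent, the sum of all \<open>3 ^ i\<close>, is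
  that of the quadratic character.\<close>

lemma prod_fr: "(\<Prod>s<n. fr s x) = x ^ ((3 ^ n - 1) div 2)"
proof -
  have "(\<Prod>s<n. fr s x) = (\<Prod>s<n. x ^ (3 ^ (k * s mod n)))"
    by (simp add: fr_def flip: pow3_mod)
  also have "\<dots> = (\<Prod>i<n. x ^ (3 ^ i))"
    by (rule prod.reindex_bij_betw[OF bij_betw_mult_mod])
  also have "\<dots> = x ^ ((3 ^ n - 1) div 2)"
    by (simp add: sum_pow3_eq flip: power_sum)
  finally show ?thesis .
qed

lemma half_power_square: "(x :: 'a) \<noteq> 0 \<Longrightarrow> (x ^ ((3 ^ n - 1) div 2))\<^sup>2 = 1"
  using power_card_minus_1[of x] by (simp flip: power_mult)

lemma half_power_cases: "(x :: 'a) \<noteq> 0 \<Longrightarrow> x ^ ((3 ^ n - 1) div 2) = 1 \<or> x ^ ((3 ^ n - 1) div 2) = - 1"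
  using half_power_square[of x] by (simp add: power2_eq_1_iff)

text \<open>Fixed under the \<open>m\<close>-th power of Frobenius, \<open>x\<close> is fixed under
  all its iterates; by Bezout one of them is Frobenius itself.\<close>

lemma pow3_fixed_imp_F3:
  assumes "gcd m n = 1" and "(x :: 'a) ^ (3 ^ m) = x"
  shows "x \<in> F3"
proof -
  have *: "x ^ (3 ^ (m * q)) = x" for q
  proof (induction q)
    case (Suc q)
    have "x ^ (3 ^ (m * Suc q)) = (x ^ (3 ^ m)) ^ (3 ^ (m * q))"
      by (simp add: power_add flip: power_mult)
    then show ?case by (simp add: assms Suc)
  qed simp
  show ?thesis
  proof (cases "m = 0")
    case True
    then have "n = 1" using assms by simp
    then show ?thesis using power_card[of x] by (simp add: F3_iff)
  next
    case False
    then obtain u v where "m * u = n * v + gcd m n" using bezout_nat by blast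
    then have "x = x ^ (3 ^ (n * v + 1))" using *[of u] assms by simp
    also have "\<dots> = x ^ (3 ^ (1 mod n))"
      using pow3_mod[of x "n * v + 1"] by (simp only: mod_mult_self3 mult.commute[of n v])
    also have "\<dots> = x ^ 3"
      using pow3_mod[of x 1] by simp
    finally show ?thesis by (simp add: F3_iff)
  qed
qed

section \<open>The absolute trace\<close>

lemma Tr_add: "Tr n (x + y) = Tr n x + Tr n (y :: 'a)"
  by (simp add: Tr_def pow3_add sum.distrib)

lemma Tr_uminus: "Tr n (- x) = - Tr n (x :: 'a)"
  using Tr_add[of x "- x"] by (simp add: eq_neg_iff_add_eq_0 add.commute Tr_def zero_power)

lemma Tr_diff: "Tr n (x - y) = Tr n x - Tr n (y :: 'a)"
  using Tr_add[of x "- y"] by (simp add: Tr_uminus)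

lemma Tr_0 [simp]: "Tr n (0 :: 'a) = 0"
  by (simp add: Tr_def zero_power)

lemma Tr_F3: "Tr n (x :: 'a) \<in> F3"
proof -
  have "Tr n x ^ 3 = (\<Sum>i<n. x ^ (3 ^ Suc i))"
    unfolding Tr_def using pow3_sum[of "\<lambda>i. x ^ (3 ^ i)" "{..<n}" 1]
    by (simp add: mult.commute flip: power_mult)
  also have "\<dots> = Tr n x + x ^ (3 ^ n) - x ^ (3 ^ 0)"
    using sum.lessThan_Suc_shift[of "\<lambda>i. x ^ (3 ^ i)" n] by (simp add: Tr_def algebra_simps)
  finally show ?thesis by (simp add: F3_iff power_card)
qed

text \<open>The trace is a nonzero polynomial of degree at most \<open>3 ^ (n - 1)\<close>, which is
  less than the number of field elements.\<close>

lemma Tr_nonzero: "\<exists>x :: 'a. Tr n x \<noteq> 0"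
proof (rule ccontr)
  assume "\<not> ?thesis"
  then have Tr0: "Tr n x = 0" for x :: 'a by simp
  define p where "p = (\<Sum>i<n. monom (1 :: 'a) (3 ^ i))"
  have "poly p x = Tr n x" for x
    by (simp add: p_def poly_sum poly_monom Tr_def)
  then have roots: "{x. poly p x = 0} = UNIV" using Tr0 by auto
  have "coeff p (3 ^ (n - 1)) = (\<Sum>i<n. if i = n - 1 then 1 else 0)"
    unfolding p_def coeff_sum by (intro sum.cong refl) simp
  then have "coeff p (3 ^ (n - 1)) = 1" using n_pos by (simp add: sum.delta)
  then have "p \<noteq> 0" by auto
  moreover have "degree p \<le> 3 ^ (n - 1)"
  proof -
    have "(3 :: nat) ^ i \<le> 3 ^ (n - 1)" if "i < n" for i
      using that by (intro power_increasing) auto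
    then show ?thesis
      unfolding p_def by (intro degree_sum_le) (auto intro!: order.trans[OF degree_monom_le])
  qed
  ultimately have "CARD('a) \<le> 3 ^ (n - 1)"
    using card_poly_roots_bound[of p] roots by simp
  moreover have "(3 :: nat) ^ (n - 1) < 3 ^ n"
    using n_pos by (intro power_strict_increasing) auto
  ultimately show False using card_eq by linarith
qed

lemma Tr_mult_nonzero:
  assumes "(c :: 'a) \<noteq> 0"
  shows "\<exists>x. Tr n (c * x) \<noteq> 0"
proof -
  obtain y :: 'a where "Tr n y \<noteq> 0" using Tr_nonzero by auto
  then show ?thesis using assms by (intro exI[of _ "y / c"]) simp
qed

text \<open>Orthogonality of characters: a shift by \<open>y\<close> with
  \<open>Tr n (c * y)\<close> nonzero multiplies the sum by a factor other than 1.\<close>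

lemma sum_chi_Tr: "(\<Sum>x\<in>UNIV. chi (Tr n (c * x))) = (if c = 0 then 3 ^ n else 0)"
proof (cases "c = 0")
  case False
  obtain y where y: "Tr n (c * y) \<noteq> 0" using Tr_mult_nonzero[OF False] by auto
  have "(\<Sum>x\<in>UNIV. chi (Tr n (c * x))) = (\<Sum>x\<in>UNIV. chi (Tr n (c * (x + y))))"
    by (rule sum.reindex_bij_witness[of _ "\<lambda>x. x + y" "\<lambda>x. x - y"]) auto
  also have "\<dots> = (\<Sum>x\<in>UNIV. chi (Tr n (c * x))) * chi (Tr n (c * y))"
    by (simp add: distrib_left Tr_add chi_add Tr_F3 sum_distrib_right)
  finally show ?thesis using chi_ne_1[OF Tr_F3 y] False by simp
qed (simp add: card_eq)

section \<open>Quadratic forms over the prime field\<close>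

text \<open>As \<open>F3\<close> consists of 0 and \<plusminus>1, additive maps are linear over
  it.\<close>

lemma additive_F3_scale:
  fixes h :: "'a \<Rightarrow> 'a"
  assumes "\<And>x y. h (x + y) = h x + h y" and "c \<in> F3"
  shows "h (c * x) = c * h x"
proof -
  have 0: "h 0 = 0" using assms(1)[of 0 0] by simp
  have "h (- x) = - h x" using assms(1)[of x "- x"] by (simp add: 0 eq_neg_iff_add_eq_0 add.commute)
  with 0 show ?thesis using assms(2) by (auto elim!: F3_cases)
qed

definition gs :: "'a \<Rightarrow> complex" where "gs d = 1 + 2 * chi d"

lemma sum_chi_square: "(\<Sum>c\<in>F3. chi (c\<^sup>2 * d)) = gs d"
  using neg_one_ne_one by (simp add: F3_eq gs_def)

lemma subgroup_F3_scale:
  assumes "0 \<in> W" and add: "\<And>x y. x \<in> W \<Longrightarrow> y \<in> W \<Longrightarrow> x + y \<in> (W :: 'a set)"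
    and "c \<in> F3" and x: "x \<in> W"
  shows "c * x \<in> W"
proof -
  have "(2 :: 'a) * x = x + x" by (rule mult_2)
  then have "- x = x + x" by simp
  then have "- x \<in> W" using add[OF x x] by metis
  with assms show ?thesis by (auto elim!: F3_cases)
qed

text \<open>Diagonalisation of a possibly degenerate symmetric form, by induction on the size of the
  subspace \<open>W\<close>. Independence of the \<open>e i\<close> is expressed by
  \<open>card W = 3 ^ m\<close> together with spanning.\<close>

lemma orthogonal_basis:
  fixes B :: "'a \<Rightarrow> 'a \<Rightarrow> 'a"
  assumes B_add: "\<And>x y z. B (x + y) z = B x z + B y z"
    and B_sym: "\<And>x y. B x y = B y x"
    and B_F3: "\<And>x y. B x y \<in> F3"
    and "0 \<in> W" and "\<And>x y. x \<in> W \<Longrightarrow> y \<in> W \<Longrightarrow> x + y \<in> W"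
  shows "\<exists>m e. card W = 3 ^ m \<and> (\<forall>i<m. e i \<in> W \<and> e i \<noteq> 0) \<and>
    (\<forall>x\<in>W. \<exists>c. (\<forall>i. c i \<in> F3) \<and> x = (\<Sum>i<m. c i * e i)) \<and>
    (\<forall>i<m. \<forall>j<m. i \<noteq> j \<longrightarrow> B (e i) (e j) = 0) \<and>
    (\<Sum>x\<in>W. chi (B x x)) = (\<Prod>i<m. gs (B (e i) (e i)))"
  using assms(4,5)
proof (induction "card W" arbitrary: W rule: less_induct)
  case less
  note add = less.prems(2)
  note scale = subgroup_F3_scale[OF less.prems]
  have B0: "B 0 y = 0" for y using B_add[of 0 0 y] by simp
  show ?case
  proof (cases "W = {0}")
    case True
    then show ?thesis by (intro exI[of _ 0]) (auto simp: B0 intro: exI[of _ "\<lambda>_. 0"])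
  next
    case False
    \<comment> \<open>An anisotropic vector splits off together with its orthogonal complement; if there is
      none, then \<open>B\<close> vanishes on \<open>W\<close> and any complement of any vector does.\<close>
    have "\<exists>w\<in>W. \<exists>h :: 'a \<Rightarrow> 'a. (\<forall>x y. h (x + y) = h x + h y) \<and> (\<forall>x. h x \<in> F3) \<and>
      h w \<noteq> 0 \<and> (\<forall>x\<in>W. h x = 0 \<longrightarrow> B x w = 0)"
    proof (cases "\<exists>w\<in>W. B w w \<noteq> 0")
      case True
      then obtain w where "w \<in> W" "B w w \<noteq> 0" by auto
      then show ?thesis
        by (intro bexI[of _ w] exI[of _ "\<lambda>x. B x w"]) (auto simp: B_add B_F3)
    next
      case iso: False
      obtain w where w: "w \<in> W" "w \<noteq> 0" using False less.prems(1) by auto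
      have B_add2: "B x (y + z) = B x y + B x z" for x y z
        using B_add B_sym by metis
      have "B x y = 0" if "x \<in> W" "y \<in> W" for x y
      proof -
        have "B (x + y) (x + y) = B x x + B y y + (B x y + B x y)"
          using B_sym[of x y] by (simp add: B_add B_add2)
        then have "B x y + B x y = 0" using iso that add[OF that] by auto
        then have "(2 :: 'a) * B x y = 0" by (simp only: mult_2)
        then show ?thesis by simp
      qed
      \<comment> \<open>The trace supplies a functional that is nonzero at \<open>w\<close>.\<close>
      moreover obtain v where "Tr n (w * v) \<noteq> 0" using Tr_mult_nonzero[OF w(2)] by auto
      ultimately show ?thesis using w
        by (intro bexI[of _ w] exI[of _ "\<lambda>x. Tr n (x * v)"])
          (auto simp: distrib_right Tr_add Tr_F3)
    qed
    then obtain w h where w: "w \<in> W" and h_add: "\<And>x y. h (x + y) = h x + h y"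
      and h_F3: "\<And>x. h x \<in> F3" and hw: "h w \<noteq> (0 :: 'a)"
      and orth: "\<And>x. x \<in> W \<Longrightarrow> h x = 0 \<Longrightarrow> B x w = 0" by blast
    note h_scale = additive_F3_scale[of h, OF h_add]
    define W' where "W' = {x \<in> W. h x = 0}"
    have "W' \<subset> W" using w hw by (auto simp: W'_def)
    then have card_less: "card W' < card W" by (intro psubset_card_mono) auto
    have h0: "h 0 = 0" using h_add[of 0 0] by simp
    obtain m e where me: "card W' = 3 ^ m" "\<forall>i<m. e i \<in> W' \<and> e i \<noteq> 0"
      "\<forall>x\<in>W'. \<exists>c. (\<forall>i. c i \<in> F3) \<and> x = (\<Sum>i<m. c i * e i)"
      "\<forall>i<m. \<forall>j<m. i \<noteq> j \<longrightarrow> B (e i) (e j) = 0"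
      "(\<Sum>x\<in>W'. chi (B x x)) = (\<Prod>i<m. gs (B (e i) (e i)))"
      using less.hyps[OF card_less] less.prems
      by (force simp: W'_def h_add h0)
    \<comment> \<open>The coordinate along \<open>w\<close>: \<open>x - c0 x * w\<close> lies in the
      kernel of \<open>h\<close>, so \<open>W\<close> is the direct sum of \<open>W'\<close> and the
      line through \<open>w\<close>.\<close>
    define c0 where "c0 x = h x / h w" for x
    have c0_F3: "c0 x \<in> F3" for x by (simp add: c0_def F3_divide h_F3)
    have proj: "x - c0 x * w \<in> W'" if "x \<in> W" for x
    proof -
      have "x + (- c0 x) * w \<in> W" by (intro add scale that w F3_uminus c0_F3)
      moreover have "h (x + (- c0 x) * w) = h x + (- c0 x) * h w"
        by (simp only: h_add h_scale[OF F3_uminus[OF c0_F3]])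
      ultimately show ?thesis using hw by (simp add: W'_def c0_def)
    qed
    have bij: "bij_betw (\<lambda>p. snd p + fst p * w) (F3 \<times> W') W"
    proof (rule bij_betw_byWitness[where f' = "\<lambda>x. (c0 x, x - c0 x * w)"])
      have "c0 (y + c * w) = c" if "c \<in> F3" "h y = 0" for c y
        using that hw by (simp add: c0_def h_add h_scale)
      then show "\<forall>p\<in>F3 \<times> W'. (c0 (snd p + fst p * w), snd p + fst p * w - c0 (snd p + fst p * w) * w) = p"
        by (auto simp: W'_def)
      show "(\<lambda>p. snd p + fst p * w) ` (F3 \<times> W') \<subseteq> W"
        by (auto simp: W'_def intro!: add scale w)
    qed (use proj c0_F3 in auto)
    define e' where "e' = e(m := w)"
    have e': "e' i = e i" if "i < m" for i using that by (simp add: e'_def)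
    have e'm: "e' m = w" by (simp add: e'_def)
    have BW': "B y w = 0" "B w y = 0" if "y \<in> W'" for y
      using that orth B_sym[of w y] by (auto simp: W'_def)
    have "card W = card (F3 :: 'a set) * card W'"
      using bij_betw_same_card[OF bij] by (simp add: card_cartesian_product)
    also have "card (F3 :: 'a set) = 3" using neg_one_ne_one by (simp add: F3_eq)
    finally have c1: "card W = 3 ^ Suc m" by (simp add: me)
    have "w \<noteq> 0" using hw h0 by auto
    then have c2: "\<forall>i<Suc m. e' i \<in> W \<and> e' i \<noteq> 0"
      using me(2) w by (auto simp: less_Suc_eq e' e'm W'_def)
    have c3: "\<forall>x\<in>W. \<exists>c. (\<forall>i. c i \<in> F3) \<and> x = (\<Sum>i<Suc m. c i * e' i)"
    proof
      fix x assume "x \<in> W"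
      then obtain c where c: "\<forall>i. c i \<in> F3" "x - c0 x * w = (\<Sum>i<m. c i * e i)"
        using proj me(3) by blast
      then have "x = (\<Sum>i<m. c i * e i) + c0 x * w" by (simp add: algebra_simps)
      also have "\<dots> = (\<Sum>i<Suc m. (c(m := c0 x)) i * e' i)"
        by (simp add: e'm e')
      finally show "\<exists>c. (\<forall>i. c i \<in> F3) \<and> x = (\<Sum>i<Suc m. c i * e' i)"
        using c(1) c0_F3 by (intro exI[of _ "c(m := c0 x)"]) auto
    qed
    have c4: "\<forall>i<Suc m. \<forall>j<Suc m. i \<noteq> j \<longrightarrow> B (e' i) (e' j) = 0"
      using me(2,4) by (auto simp: less_Suc_eq e' e'm BW')
    \<comment> \<open>By orthogonality of \<open>w\<close> and \<open>W'\<close> the sum factors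
      into one over the line and one over \<open>W'\<close>.\<close>
    have "(\<Sum>x\<in>W. chi (B x x)) =
        (\<Sum>c\<in>F3. \<Sum>y\<in>W'. chi (B (y + c * w) (y + c * w)))"
      by (simp add: sum.cartesian_product case_prod_beta flip: sum.reindex_bij_betw[OF bij])
    also have "\<dots> = (\<Sum>c\<in>F3. \<Sum>y\<in>W'. chi (c\<^sup>2 * B w w) * chi (B y y))"
    proof (intro sum.cong refl)
      fix c y assume c: "c \<in> (F3 :: 'a set)" and y: "y \<in> W'"
      have "B x (c * z) = c * B x z" for x z
        using additive_F3_scale[of "\<lambda>z. B z x", OF B_add c] B_sym by metis
      moreover have "B (c * x) z = c * B x z" for x z
        using additive_F3_scale[of "\<lambda>x. B x z", OF B_add c] .
      moreover have "B x (u + z) = B x u + B x z" for x u z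
        using B_add B_sym by metis
      ultimately have "B (y + c * w) (y + c * w) = c\<^sup>2 * B w w + B y y"
        using y by (simp add: B_add BW' power2_eq_square mult.assoc)
      then show "chi (B (y + c * w) (y + c * w)) = chi (c\<^sup>2 * B w w) * chi (B y y)"
        using c by (simp add: chi_add F3_mult B_F3 power2_eq_square)
    qed
    also have "\<dots> = gs (B w w) * (\<Prod>i<m. gs (B (e i) (e i)))"
      unfolding me(5)[symmetric] sum_chi_square[of "B w w", symmetric] by (simp add: sum_product)
    also have "\<dots> = (\<Prod>i<Suc m. gs (B (e' i) (e' i)))"
      by (simp add: e' e'm mult.commute)
    finally show ?thesis using c1 c2 c3 c4 by blast
  qed
qed

section \<open>Forms in the conjugates and their discriminants\<close>

definition form :: "'a mat \<Rightarrow> 'a \<Rightarrow> 'a \<Rightarrow> 'a" where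
  "form M x y = (\<Sum>s<n. \<Sum>t<n. M $$ (s, t) * fr s x * fr t y)"

text \<open>For a basis \<open>e\<close>, the square of its determinant is the discriminant of the
  basis.\<close>

definition conj_mat :: "(nat \<Rightarrow> 'a) \<Rightarrow> 'a mat" where
  "conj_mat e = mat n n (\<lambda>(s, j). fr s (e j))"

lemma conj_mat_carrier [simp]: "conj_mat e \<in> carrier_mat n n"
  by (simp add: conj_mat_def)

text \<open>The field has \<open>3 ^ n\<close> elements, so \<open>n\<close> elements that span it
  form a basis.\<close>

definition spanning :: "(nat \<Rightarrow> 'a) \<Rightarrow> bool" where
  "spanning e \<longleftrightarrow> (\<forall>x. \<exists>c. (\<forall>i. c i \<in> F3) \<and> x = (\<Sum>i<n. c i * e i))"

lemma form_add_left: "form M (x + y) z = form M x z + form M y z"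
  by (simp add: form_def fr_add algebra_simps sum.distrib)

lemma form_commute:
  assumes M: "M \<in> carrier_mat n n" and sym: "M\<^sup>T = M"
  shows "form M x y = form M y x"
proof -
  have "M $$ (s, t) = M $$ (t, s)" if "s < n" "t < n" for s t
    using M that sym by (metis carrier_matD index_transpose_mat(1))
  then have "(\<Sum>s<n. \<Sum>t<n. M $$ (s, t) * fr s x * fr t y) = (\<Sum>s<n. \<Sum>t<n. M $$ (t, s) * fr t y * fr s x)"
    by (intro sum.cong refl) simp
  then show ?thesis unfolding form_def by (subst sum.swap)
qed

lemma det_F3:
  assumes P: "P \<in> carrier_mat n n" and "\<And>i j. i < n \<Longrightarrow> j < n \<Longrightarrow> P $$ (i, j) \<in> F3"
  shows "det P \<in> (F3 :: 'a set)"
  unfolding det_def'[OF P]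
proof (intro F3_sum F3_mult F3_prod assms)
  fix p assume p: "p \<in> {p. p permutes {0..<n}}"
  show "signof p \<in> (F3 :: 'a set)" by (simp add: sign_def)
  fix i assume "i \<in> {0..<n}"
  then show "i < n" "p i < n" using p permutes_in_image[of p "{0..<n}" i] by auto
qed

text \<open>The matrix \<open>P\<close> expressing \<open>e0\<close> in terms of \<open>e\<close>
  has entries in \<open>F3\<close>, which \<open>fr\<close> fixes, so
  \<open>conj_mat e0 = conj_mat e * P\<close>. Its determinant is a nonzero element of
  \<open>F3\<close> and has square 1.\<close>

lemma det_conj_mat_square_unique:
  assumes e: "spanning e" and e0: "det (conj_mat e0) \<noteq> 0"
  shows "(det (conj_mat e))\<^sup>2 = (det (conj_mat e0))\<^sup>2"
proof -
  have "\<forall>j. \<exists>c. (\<forall>i. c i \<in> F3) \<and> e0 j = (\<Sum>i<n. c i * e i)"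
    using e by (simp add: spanning_def)
  then obtain c where c: "\<And>j i. c j i \<in> F3" "\<And>j. e0 j = (\<Sum>i<n. c j i * e i)"
    by metis
  define P where "P = mat n n (\<lambda>(i, j). c j i)"
  have P: "P \<in> carrier_mat n n" by (simp add: P_def)
  have "conj_mat e0 = conj_mat e * P"
  proof (rule eq_matI)
    fix s j assume "s < dim_row (conj_mat e * P)" "j < dim_col (conj_mat e * P)"
    then have sj: "s < n" "j < n" by (simp_all add: conj_mat_def P_def)
    then show "conj_mat e0 $$ (s, j) = (conj_mat e * P) $$ (s, j)"
      by (simp add: conj_mat_def P_def scalar_prod_def lessThan_atLeast0 c(2) fr_sum fr_mult
          fr_F3[OF c(1)] mult.commute)
  qed (simp_all add: conj_mat_def P_def)
  then have det: "det (conj_mat e0) = det (conj_mat e) * det P"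
    using det_mult[OF conj_mat_carrier P] by simp
  have "det P \<in> F3" by (rule det_F3[OF P]) (simp add: P_def c)
  then have "(det P)\<^sup>2 = 1" using det e0 by (intro F3_square) auto
  then show ?thesis by (simp add: det power_mult_distrib)
qed

text \<open>The Gram matrix of \<open>e\<close> arises from \<open>M\<close> by congruence with
  \<open>conj_mat e\<close>, and orthogonality makes it diagonal.\<close>

lemma prod_orthogonal_form:
  assumes M: "M \<in> carrier_mat n n" and orth: "\<forall>i<n. \<forall>j<n. i \<noteq> j \<longrightarrow> form M (e i) (e j) = 0"
  shows "(\<Prod>i<n. form M (e i) (e i)) = (det (conj_mat e))\<^sup>2 * det M"
proof -
  define D where "D = (conj_mat e)\<^sup>T * (M * conj_mat e)"
  have D: "D \<in> carrier_mat n n"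
    unfolding D_def using M by (intro mult_carrier_mat[of _ n n]) auto
  have entry: "D $$ (i, j) = form M (e i) (e j)" if "i < n" "j < n" for i j
    using that M
    by (simp add: D_def form_def conj_mat_def scalar_prod_def lessThan_atLeast0
        sum_distrib_left sum_distrib_right mult_ac)
  have "det D = prod_list (diag_mat D)"
    by (rule det_lower_triangular[OF _ D]) (simp add: entry orth)
  also have "\<dots> = (\<Prod>i<n. form M (e i) (e i))"
    using D by (simp add: prod_list_diag_prod lessThan_atLeast0 entry)
  finally have "(\<Prod>i<n. form M (e i) (e i)) = det D" ..
  also have "det D = det ((conj_mat e)\<^sup>T) * (det M * det (conj_mat e))"
    unfolding D_def using M by (simp add: det_mult[of _ n])
  also have "det ((conj_mat e)\<^sup>T) = det (conj_mat e)"
    by (rule det_transpose[OF conj_mat_carrier])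
  finally show ?thesis by (simp add: power2_eq_square)
qed

lemma orthogonal_basis_form:
  assumes M: "M \<in> carrier_mat n n" "M\<^sup>T = M" and F3: "\<And>x y. form M x y \<in> F3"
  shows "\<exists>e. spanning e \<and> (\<forall>i<n. e i \<noteq> 0) \<and> (\<forall>i<n. \<forall>j<n. i \<noteq> j \<longrightarrow> form M (e i) (e j) = 0) \<and>
    (\<Sum>x\<in>UNIV. chi (form M x x)) = (\<Prod>i<n. gs (form M (e i) (e i)))"
proof -
  obtain m e where m: "CARD('a) = 3 ^ m"
    and e: "\<forall>i<m. e i \<noteq> 0" "\<forall>x. \<exists>c. (\<forall>i. c i \<in> F3) \<and> x = (\<Sum>i<m. c i * e i)"
      "\<forall>i<m. \<forall>j<m. i \<noteq> j \<longrightarrow> form M (e i) (e j) = 0"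
      "(\<Sum>x\<in>UNIV. chi (form M x x)) = (\<Prod>i<m. gs (form M (e i) (e i)))"
    using orthogonal_basis[of "form M" UNIV, OF form_add_left form_commute[OF M] F3] by auto
  have "m = n" using m card_eq by simp
  with e show ?thesis unfolding spanning_def by blast
qed

text \<open>The identity matrix gives the trace form. For an orthogonal basis \<open>e\<close> of
  it, the squared determinant is the product of the \<open>Tr n (e i * e i)\<close>. A zero factor
  would make \<open>e i\<close> orthogonal to the whole field, against nondegeneracy of the trace
  form.\<close>

lemma ex_discriminant: "\<exists>\<Delta>\<in>F3. \<Delta> \<noteq> 0 \<and> (\<forall>e. spanning e \<longrightarrow> (det (conj_mat e))\<^sup>2 = \<Delta>)"
proof -
  have one: "form (1\<^sub>m n) x y = Tr n (x * y)" for x y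
  proof -
    have "form (1\<^sub>m n) x y = (\<Sum>s<n. \<Sum>t<n. if t = s then fr s x * fr s y else 0)"
      unfolding form_def by (intro sum.cong refl) auto
    then show ?thesis by (simp add: sum_fr flip: fr_mult)
  qed
  obtain e where e: "spanning e" "\<forall>i<n. \<forall>j<n. i \<noteq> j \<longrightarrow> Tr n (e i * e j) = 0"
    "\<forall>i<n. e i \<noteq> 0"
    using orthogonal_basis_form[of "1\<^sub>m n"] by (auto simp: one Tr_F3)
  define \<Delta> where "\<Delta> = (det (conj_mat e))\<^sup>2"
  have prod: "(\<Prod>i<n. Tr n (e i * e i)) = \<Delta>"
    using prod_orthogonal_form[of "1\<^sub>m n" e] e by (simp add: one \<Delta>_def)
  have "Tr n (e i * e i) \<noteq> 0" if i: "i < n" for i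
  proof
    assume zero: "Tr n (e i * e i) = 0"
    have Tr_e: "Tr n (e i * x) = 0" for x
    proof -
      obtain c where c: "\<And>i. c i \<in> F3" "x = (\<Sum>j<n. c j * e j)"
        using e(1) unfolding spanning_def by blast
      have "Tr n (e i * (\<Sum>j\<in>J. c j * e j)) = (\<Sum>j\<in>J. c j * Tr n (e i * e j))" if "finite J" for J
        using that
      proof induction
        case (insert j J)
        have "Tr n (e i * (c j * e j)) = c j * Tr n (e i * e j)"
          using additive_F3_scale[of "Tr n", OF Tr_add c(1)[of j], of "e i * e j"]
          by (simp add: mult.left_commute)
        then show ?case using insert by (simp add: distrib_left Tr_add)
      qed simp
      also have "(\<Sum>j<n. c j * Tr n (e i * e j)) = 0"
      proof (rule sum.neutral, safe)
        fix j assume "j < n"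
        then show "c j * Tr n (e i * e j) = 0" using e(2) i zero by (cases "i = j") auto
      qed
      finally show ?thesis by (simp add: c(2))
    qed
    then have "e i = 0" using Tr_mult_nonzero by metis
    then show False using e(3) i by simp
  qed
  then have "\<Delta> \<noteq> 0" using prod by auto
  moreover have "\<Delta> \<in> F3" unfolding prod[symmetric] by (intro F3_prod Tr_F3)
  ultimately show ?thesis
    using det_conj_mat_square_unique[of _ e] by (intro bexI[of _ \<Delta>]) (auto simp: \<Delta>_def)
qed

text \<open>The discriminant of the trace form \<open>Tr (x y)\<close> modulo squares.\<close>

definition \<Delta> :: 'a where
  "\<Delta> = (SOME \<Delta>. \<Delta> \<in> F3 \<and> \<Delta> \<noteq> 0 \<and> (\<forall>e. spanning e \<longrightarrow> (det (conj_mat e))\<^sup>2 = \<Delta>))"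

lemma \<Delta>: "\<Delta> \<in> F3" "\<Delta> \<noteq> 0" "spanning e \<Longrightarrow> (det (conj_mat e))\<^sup>2 = \<Delta>"
proof -
  have "\<exists>\<Delta>. \<Delta> \<in> F3 \<and> \<Delta> \<noteq> 0 \<and> (\<forall>e. spanning e \<longrightarrow> (det (conj_mat e))\<^sup>2 = \<Delta>)"
    using ex_discriminant by blast
  from someI_ex[OF this] show "\<Delta> \<in> F3" "\<Delta> \<noteq> 0" "spanning e \<Longrightarrow> (det (conj_mat e))\<^sup>2 = \<Delta>"
    unfolding \<Delta>_def by blast+
qed

section \<open>Gauss sums of quadratic forms\<close>

lemma gs_values: "gs 0 = - (G * G)" "gs 1 = G" "gs (- 1) = - G"
proof -
  show "gs 1 = G" by (simp add: gs_def chi_1 omega_G(1) field_simps)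
  show "gs (- 1) = - G" by (simp only: gs_def chi_neg_1 omega_G(2)) (simp add: field_simps)
qed (simp add: gs_def G_square)

text \<open>Lifts the signs \<open>1\<close> and \<open>- 1\<close> of the field to complex ones;
  the value elsewhere is a default.\<close>

definition sg :: "'a \<Rightarrow> complex" where "sg x = (if x = 1 then 1 else - 1)"

text \<open>Each \<open>gs (d i)\<close> is a sign times \<open>G\<close>, or
  \<open>- (G * G)\<close> if \<open>d i = 0\<close>. So \<open>r\<close> is the number of vanishing
  \<open>d i\<close>, and if there are none, the sign is that of the product.\<close>

lemma prod_gs:
  assumes "\<And>i. i < m \<Longrightarrow> d i \<in> F3"
  shows "\<exists>r \<delta>. (\<Prod>i<m. gs (d i)) = \<delta> * G ^ (m + r) \<and> (\<delta> = 1 \<or> \<delta> = - 1) \<and>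
    (if (\<Prod>i<m. d i) = 0 then r \<ge> 1 else r = 0 \<and> \<delta> = sg (\<Prod>i<m. d i))"
  using assms
proof (induction m)
  case 0
  then show ?case by (intro exI[of _ 0] exI[of _ 1]) (simp add: sg_def)
next
  case (Suc m)
  define p q where "p = (\<Prod>i<m. d i)" and "q = (\<Prod>i<m. gs (d i))"
  obtain r \<delta> where IH: "q = \<delta> * G ^ (m + r)" "\<delta> = 1 \<or> \<delta> = - 1"
    "if p = 0 then r \<ge> 1 else r = 0 \<and> \<delta> = sg p"
    using Suc.IH[OF Suc.prems[OF less_SucI]] unfolding p_def[symmetric] q_def[symmetric] by blast
  have p: "p \<in> F3" unfolding p_def using Suc.prems by (intro F3_prod) auto
  have "d m \<in> F3" using Suc.prems by auto
  then show ?case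
    unfolding prod.lessThan_Suc p_def[symmetric] q_def[symmetric]
  proof (rule F3_cases)
    assume "d m = 0"
    then show "\<exists>r \<delta>. q * gs (d m) = \<delta> * G ^ (Suc m + r) \<and> (\<delta> = 1 \<or> \<delta> = - 1) \<and>
        (if p * d m = 0 then r \<ge> 1 else r = 0 \<and> \<delta> = sg (p * d m))"
      using IH by (intro exI[of _ "Suc r"] exI[of _ "- \<delta>"]) (auto simp: gs_values)
  next
    assume "d m = 1"
    then show "\<exists>r \<delta>. q * gs (d m) = \<delta> * G ^ (Suc m + r) \<and> (\<delta> = 1 \<or> \<delta> = - 1) \<and>
        (if p * d m = 0 then r \<ge> 1 else r = 0 \<and> \<delta> = sg (p * d m))"
      using IH by (intro exI[of _ r] exI[of _ \<delta>]) (auto simp: gs_values)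
  next
    assume "d m = - 1"
    moreover have "sg (- p) = - sg p" if "p \<noteq> 0"
      using p that neg_one_ne_one by (auto elim!: F3_cases simp: sg_def)
    ultimately show "\<exists>r \<delta>. q * gs (d m) = \<delta> * G ^ (Suc m + r) \<and> (\<delta> = 1 \<or> \<delta> = - 1) \<and>
        (if p * d m = 0 then r \<ge> 1 else r = 0 \<and> \<delta> = sg (p * d m))"
      using IH by (intro exI[of _ r] exI[of _ "- \<delta>"]) (auto simp: gs_values split: if_splits)
  qed
qed

text \<open>In an orthogonal basis the sum is a product of one-dimensional sums, and the diagonal
  values multiply to \<open>\<Delta> * det M\<close>. The determinant thus fixes the sum of a
  nondegenerate form; a degenerate one gains extra factors \<open>G\<close>.\<close>

lemma quadratic_gauss_sum:
  assumes M: "M \<in> carrier_mat n n" "M\<^sup>T = M" and F3: "\<And>x y. form M x y \<in> F3"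
  shows "\<Delta> * det M \<in> F3 \<and> (\<exists>r \<delta>. (\<Sum>x\<in>UNIV. chi (form M x x)) = \<delta> * G ^ (n + r) \<and>
    (\<delta> = 1 \<or> \<delta> = - 1) \<and> (if det M = 0 then r \<ge> 1 else r = 0 \<and> \<delta> = sg (\<Delta> * det M)))"
proof -
  obtain e where e: "spanning e" "\<forall>i<n. \<forall>j<n. i \<noteq> j \<longrightarrow> form M (e i) (e j) = 0"
    "(\<Sum>x\<in>UNIV. chi (form M x x)) = (\<Prod>i<n. gs (form M (e i) (e i)))"
    using orthogonal_basis_form[OF assms] by blast
  have prod: "(\<Prod>i<n. form M (e i) (e i)) = \<Delta> * det M"
    using prod_orthogonal_form[OF M(1) e(2)] \<Delta>(3)[OF e(1)] by simp
  have "\<Delta> * det M \<in> F3" unfolding prod[symmetric] by (intro F3_prod F3)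
  moreover have "\<Delta> * det M = 0 \<longleftrightarrow> det M = 0" using \<Delta>(2) by simp
  ultimately show ?thesis
    using prod_gs[of n "\<lambda>i. form M (e i) (e i)", OF F3] by (simp only: prod e(3) simp_thms)
qed

section \<open>The Walsh transform of Coulter-Matthews functions\<close>

text \<open>The minus sign at \<open>a\<close> is the division by 2 of polarisation: on the diagonal
  the two mixed terms coincide, and their factor 2 is \<open>- 1\<close>.\<close>

definition qmat :: "'a \<Rightarrow> 'a \<Rightarrow> 'a mat" where
  "qmat a b = jacobi_mat n (\<lambda>s. fr s (- b)) (\<lambda>s. fr s (- a)) (fr (n - 1) (- a)) (fr (n - 1) (- a))"

lemma qmat_carrier [simp]: "qmat a b \<in> carrier_mat n n"
  by (simp add: qmat_def)

lemma qmat_transpose: "(qmat a b)\<^sup>T = qmat a b"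
  by (intro eq_matI) (auto simp: qmat_def jacobi_mat_def)

lemma form_qmat: "form (qmat a b) x y = Tr n (- b * x * y + - a * (x * y ^ (3 ^ k) + x ^ (3 ^ k) * y))"
proof -
  have "form (qmat a b) x y =
      (\<Sum>s<n. fr s (- b) * fr s x * fr s y + fr s (- a) * (fr s x * fr (Suc s) y + fr (Suc s) x * fr s y))"
    unfolding form_def qmat_def by (rule jacobi_mat_form[OF n_pos]) simp_all
  then show ?thesis
    unfolding sum_fr[symmetric] by (simp only: fr_Suc fr_add fr_mult)
qed

lemma form_qmat_diag: "form (qmat a b) x x = Tr n (a * x ^ (3 ^ k + 1) - b * x\<^sup>2)"
proof -
  have "x * x ^ (3 ^ k) + x ^ (3 ^ k) * x = 2 * x ^ (3 ^ k + 1)"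
    by (simp only: mult_2 power_add power_one_right mult.commute)
  then show ?thesis by (simp add: form_qmat power2_eq_square mult.assoc)
qed

lemma form_qmat_F3: "form (qmat a b) x y \<in> F3"
  by (simp only: form_qmat Tr_F3)

section \<open>Twisting by a non-square\<close>

definition d :: nat where "d = (3 ^ k + 1) div 2"

lemma two_d: "2 * d = 3 ^ k + 1"
  by (simp add: d_def)

text \<open>\<open>rho g s\<close> is the quotient of \<open>h\<^bsup>3^(ks)\<^esup>\<close> and \<open>h\<close> for a square root \<open>h\<close> of \<open>g\<close> in the quadratic
  extension. This rescaling carries the form of \<open>(a, b)\<close> to the one of \<open>(a g\<^sup>d, b g)\<close>, up to the sign
  of the corner entries, which comes from \<open>h\<^bsup>3^(kn)\<^esup> = - h\<close> for non-square \<open>g\<close>.\<close>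

definition rho :: "'a \<Rightarrow> nat \<Rightarrow> 'a" where "rho g s = g ^ ((3 ^ (k * s) - 1) div 2)"

lemma pow3_odd: obtains t where "3 ^ j = 2 * t + (1 :: nat)"
proof -
  have "odd (3 ^ j :: nat)" by simp
  then show ?thesis using that by (rule oddE)
qed

lemma rho_square: "g * (rho g s)\<^sup>2 = fr s g"
proof -
  obtain t where t: "3 ^ (k * s) = 2 * t + (1 :: nat)" by (rule pow3_odd)
  then show ?thesis by (simp add: rho_def fr_def power_add power_mult power2_eq_square mult_2)
qed

text \<open>For \<open>q = 3 ^ k\<close> this is the identity of exponents 1 + (q^s - 1)/2 +
  (q^(s+1) - 1)/2 = q^s (q + 1)/2.\<close>

lemma rho_mult: "g * rho g s * rho g (Suc s) = fr s (g ^ d)"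
proof -
  obtain t where t: "3 ^ (k * s) = 2 * t + (1 :: nat)" by (rule pow3_odd)
  obtain r where r: "3 ^ k = 2 * r + (1 :: nat)" by (rule pow3_odd)
  have "3 ^ (k * Suc s) = (2 * t + 1) * (2 * r + (1 :: nat))"
    by (simp only: t r mult_Suc_right power_add mult.commute)
  then have "(3 ^ (k * Suc s) - 1) div 2 = 2 * t * r + t + r"
    by (simp add: algebra_simps)
  then have "g * rho g s * rho g (Suc s) = g ^ (1 + t + (2 * t * r + t + r))"
    using t by (simp only: rho_def power_add power_one_right) simp
  also have "1 + t + (2 * t * r + t + r) = (r + 1) * (2 * t + 1)" by (simp add: algebra_simps)
  also have "r + 1 = d" using r by (simp add: d_def)
  also have "g ^ (d * (2 * t + 1)) = fr s (g ^ d)" by (simp only: fr_def t power_mult[of g d])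
  finally show ?thesis .
qed

text \<open>The exponent is \<open>(3 ^ n - 1) div 2\<close> times a sum of \<open>k\<close> powers
  of \<open>3 ^ n\<close>, all odd, so the value is \<open>(- 1) ^ k\<close>.\<close>

lemma rho_n:
  assumes g: "g ^ ((3 ^ n - 1) div 2) = - 1" and "odd k"
  shows "rho g n = - 1"
proof -
  obtain r where r: "3 ^ n = 2 * r + (1 :: nat)" by (rule pow3_odd)
  have "g ^ ((3 ^ (m * n) - 1) div 2) = (- 1) ^ m" for m
  proof (induction m)
    case (Suc m)
    obtain t where t: "3 ^ (m * n) = 2 * t + (1 :: nat)" by (rule pow3_odd)
    have "3 ^ (Suc m * n) = 3 ^ (m * n) * (3 ^ n :: nat)"
      by (simp add: power_add)
    then have "3 ^ (Suc m * n) = (2 * t + 1) * (2 * r + (1 :: nat))"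
      by (simp only: t r)
    then have "(3 ^ (Suc m * n) - 1) div 2 = t + r * (2 * t + 1)"
      by (simp add: algebra_simps)
    moreover have "g ^ t = (- 1) ^ m" "g ^ r = - 1" using Suc g t r by auto
    ultimately show ?case by (simp add: power_add power_mult)
  qed simp
  from this[of k] show ?thesis using \<open>odd k\<close> by (simp add: rho_def)
qed

text \<open>Rows are scaled by \<open>g * rho g s\<close> and columns by \<open>rho g t\<close>; all
  factors together give the norm of \<open>g\<close>, which is \<open>- 1\<close>. The corners
  change sign because the index wraps around there and \<open>rho g n = - 1\<close> while
  \<open>rho g 0 = 1\<close>.\<close>

lemma det_qmat_twist:
  assumes g: "g ^ ((3 ^ n - 1) div 2) = - 1" and "odd k"
  shows "det (qmat (a * g ^ d) (b * g)) =
    - det (jacobi_mat n (\<lambda>s. fr s (- b)) (\<lambda>s. fr s (- a)) (- fr (n - 1) (- a)) (- fr (n - 1) (- a)))"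
    (is "det ?B = - det ?A")
proof -
  let ?c = "\<lambda>s. g * rho g s" and ?d = "rho g"
  have diag: "fr s (- (b * g)) = ?c s * ?d s * fr s (- b)" for s
    by (simp add: fr_uminus fr_mult power2_eq_square rho_square[of g s, symmetric])
  have off: "fr s (- (a * g ^ d)) = ?c s * ?d (Suc s) * fr s (- a)" for s
    by (simp add: fr_uminus fr_mult rho_mult[of g s, symmetric])
  have rho_0: "?d 0 = 1" by (simp add: rho_def)
  have "det ?B = (\<Prod>s<n. ?c s) * (\<Prod>s<n. ?d s) * det ?A"
  proof (rule det_scale)
    fix s t assume "s < n" "t < n"
    then show "?B $$ (s, t) = ?c s * ?d t * ?A $$ (s, t)"
      unfolding qmat_def jacobi_mat_def
      \<comment> \<open>The five summands of an entry are compared one by one, since they may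
        overlap for small \<open>n\<close>.\<close>
      by (simp only: index_mat prod.case distrib_left, intro arg_cong2[where f = "(+)"])
        (use n_pos in \<open>auto simp: diag off rho_0 rho_n[OF assms]\<close>)
  qed simp_all
  also have "(\<Prod>s<n. ?c s) * (\<Prod>s<n. ?d s) = (\<Prod>s<n. fr s g)"
    by (simp add: mult.assoc power2_eq_square flip: prod.distrib rho_square)
  finally show ?thesis unfolding prod_fr g by simp
qed

text \<open>After the twist the sum is a difference of determinants with opposite corners, in which
  \<open>b\<close> cancels. Corner and off-diagonal entries multiply to the norm of
  \<open>- a\<close>, and the factor 4 is 1.\<close>

lemma det_qmat_sum:
  assumes "g ^ ((3 ^ n - 1) div 2) = - 1" and "odd k"
  shows "det (qmat a b) + det (qmat (a * g ^ d) (b * g)) =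
    (- 1) ^ (n - 1) * (- a) ^ ((3 ^ n - 1) div 2)"
proof -
  obtain m where n: "n = Suc m" using n_pos by (cases n) auto
  have four: "(4 :: 'a) = 1"
  proof -
    have "(4 :: 'a) = 3 + 1" by (simp del: three_eq_0)
    then show ?thesis by simp
  qed
  have "fr (n - 1) (- a) * (\<Prod>s<n - 1. fr s (- a)) = (\<Prod>s<n. fr s (- a))"
    by (simp add: n mult.commute)
  then show ?thesis
    unfolding det_qmat_twist[OF assms] unfolding qmat_def
    using det_jacobi_mat_corner[OF n_pos, of "\<lambda>s. fr s (- b)" "\<lambda>s. fr s (- a)" "fr (n - 1) (- a)"]
    by (simp add: four prod_fr)
qed

section \<open>Squares, non-squares and the values of the Walsh transform\<close>

lemma ex_nonsquare: "\<exists>g :: 'a. g ^ ((3 ^ n - 1) div 2) = - 1"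
proof (rule ccontr)
  assume none: "\<not> ?thesis"
  define N where "N = (3 ^ n - 1) div (2 :: nat)"
  have "(3 :: nat) ^ 1 \<le> 3 ^ n" using n_pos by (intro power_increasing) auto
  then have N: "0 < N" "N < 3 ^ n - 1" by (auto simp: N_def)
  \<comment> \<open>Without a non-square all \<open>3 ^ n - 1\<close> nonzero elements would be
    roots of this polynomial of degree \<open>N\<close>.\<close>
  define p where "p = monom (1 :: 'a) N - 1"
  have "coeff p N = 1" using N by (simp add: p_def)
  then have "p \<noteq> 0" by auto
  have "degree p \<le> N" unfolding p_def by (intro degree_diff_le) (auto intro: degree_monom_le)
  moreover have "poly p x = 0" if "x \<noteq> 0" for x
    using that half_power_cases[of x] none by (auto simp: p_def poly_monom N_def)
  then have "UNIV - {0} \<subseteq> {x. poly p x = 0}" by auto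
  then have "card (UNIV - {0 :: 'a}) \<le> card {x. poly p x = 0}"
    by (intro card_mono) auto
  moreover have "card (UNIV - {0 :: 'a}) = 3 ^ n - 1" by (simp add: card_Diff_singleton card_eq)
  ultimately show False using card_poly_roots_bound[OF \<open>p \<noteq> 0\<close>] N by linarith
qed

text \<open>Every \<open>z\<close> is hit exactly twice by the squares and their
  \<open>g\<close>-multiples together: at most twice, since a nonzero \<open>z\<close> cannot be of
  both kinds, and twice on average by counting.\<close>

lemma sum_over_squares:
  fixes h :: "'a \<Rightarrow> complex"
  assumes g: "g ^ ((3 ^ n - 1) div 2) = - 1"
  shows "2 * (\<Sum>x\<in>UNIV. h x) = (\<Sum>y\<in>UNIV. h (y\<^sup>2)) + (\<Sum>y\<in>UNIV. h (g * y\<^sup>2))"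
proof -
  define A where "A z = {y :: 'a. y\<^sup>2 = z}" for z
  define A' where "A' z = {y :: 'a. g * y\<^sup>2 = z}" for z
  have "(3 :: nat) ^ 1 \<le> 3 ^ n" using n_pos by (intro power_increasing) auto
  then have "g \<noteq> 0" using g by (auto simp: zero_power)
  have two: "card {y :: 'a. y\<^sup>2 = z} \<le> 2" for z
  proof (cases "\<exists>w. w\<^sup>2 = z")
    case True
    then obtain w where "w\<^sup>2 = z" by auto
    then have "{y. y\<^sup>2 = z} \<subseteq> {w, - w}" by (auto simp: power2_eq_iff)
    then have "card {y. y\<^sup>2 = z} \<le> card {w, - w}" by (intro card_mono) auto
    also have "\<dots> \<le> 2" by (simp add: card_insert_if)
    finally show ?thesis .
  qed simp
  have le: "card (A z) + card (A' z) \<le> 2" for z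
  proof (cases "z = 0")
    case True
    then have "A z = {0}" "A' z = {0}" using \<open>g \<noteq> 0\<close> by (auto simp: A_def A'_def)
    then show ?thesis by simp
  next
    case False
    have "A' z = {y. y\<^sup>2 = z / g}" using \<open>g \<noteq> 0\<close> by (auto simp: A'_def field_simps)
    then have "card (A' z) \<le> 2" "card (A z) \<le> 2" using two by (simp_all add: A_def)
    moreover have "A z = {} \<or> A' z = {}"
    proof (rule ccontr)
      assume "\<not> ?thesis"
      then obtain x y where xy: "x\<^sup>2 = z" "g * y\<^sup>2 = z" by (auto simp: A_def A'_def)
      have sq: "(w\<^sup>2) ^ ((3 ^ n - 1) div 2) = 1" if "w \<noteq> 0" for w :: 'a
        using half_power_square[OF that] by (metis mult.commute power_mult)
      have "x \<noteq> 0" "y \<noteq> 0" using xy False by auto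
      have "z ^ ((3 ^ n - 1) div 2) = 1" unfolding xy(1)[symmetric] by (rule sq[OF \<open>x \<noteq> 0\<close>])
      moreover have "z ^ ((3 ^ n - 1) div 2) = - 1"
        unfolding xy(2)[symmetric] power_mult_distrib g sq[OF \<open>y \<noteq> 0\<close>] by simp
      ultimately show False using neg_one_ne_one by simp
    qed
    ultimately show ?thesis by auto
  qed
  have group: "(\<Sum>y\<in>UNIV. F (s y)) = (\<Sum>z\<in>UNIV. of_nat (card {y. s y = z}) * F z)"
    for s :: "'a \<Rightarrow> 'a" and F :: "'a \<Rightarrow> complex"
  proof -
    have "(\<Sum>y\<in>UNIV. F (s y)) = (\<Sum>z\<in>UNIV. \<Sum>y\<in>{y \<in> UNIV. s y = z}. F (s y))"
      by (rule sum.group[symmetric]) auto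
    also have "\<dots> = (\<Sum>z\<in>UNIV. of_nat (card {y. s y = z}) * F z)"
      by (intro sum.cong refl) simp
    finally show ?thesis .
  qed
  have "(\<Sum>z\<in>UNIV. of_nat (card (A z) + card (A' z)) :: complex) = (\<Sum>z\<in>(UNIV :: 'a set). 2)"
    using group[of "\<lambda>_. 1" "\<lambda>y. y\<^sup>2"] group[of "\<lambda>_. 1" "\<lambda>y. g * y\<^sup>2"]
    by (simp add: sum.distrib A_def A'_def)
  then have "of_nat (\<Sum>z\<in>UNIV. card (A z) + card (A' z)) = (of_nat (\<Sum>z\<in>(UNIV :: 'a set). 2) :: complex)"
    by simp
  then have total: "(\<Sum>z\<in>UNIV. card (A z) + card (A' z)) = (\<Sum>z\<in>(UNIV :: 'a set). 2)"
    by (simp only: of_nat_eq_iff)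
  have eq: "card (A z) + card (A' z) = 2" for z
    using sum_mono_inv[OF total] le by simp
  have "(\<Sum>y\<in>UNIV. h (y\<^sup>2)) + (\<Sum>y\<in>UNIV. h (g * y\<^sup>2)) =
      (\<Sum>z\<in>UNIV. of_nat (card (A z) + card (A' z)) * h z)"
    by (simp add: group[of h "\<lambda>y. y\<^sup>2"] group[of h "\<lambda>y. g * y\<^sup>2"] A_def A'_def algebra_simps sum.distrib)
  also have "\<dots> = 2 * (\<Sum>x\<in>UNIV. h x)"
    by (simp add: eq sum_distrib_left)
  finally show ?thesis by simp
qed

lemma walsh_value:
  fixes a :: 'a
  assumes "odd k" and "a \<noteq> 0"
  obtains \<epsilon> where "\<epsilon> = 1 \<or> \<epsilon> = - 1"
    "\<And>b. \<exists>w. walsh n (coulter_matthews n k a) b = \<epsilon> * G ^ n * w \<and> (w \<in> {1, \<omega>, \<omega>\<^sup>2} \<or> cmod w > 1)"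
proof -
  obtain g :: 'a where g: "g ^ ((3 ^ n - 1) div 2) = - 1" using ex_nonsquare by auto
  \<comment> \<open>The sum of the two discriminants; it does not involve \<open>b\<close>.\<close>
  define e where "e = \<Delta> * ((- 1) ^ (n - 1) * (- a) ^ ((3 ^ n - 1) div 2))"
  have "((- 1) ^ (n - 1) :: 'a) = 1 \<or> ((- 1) ^ (n - 1) :: 'a) = - 1"
    by (cases "even (n - 1)") auto
  then have e: "e = 1 \<or> e = - 1"
    using half_power_cases[of "- a"] \<open>a \<noteq> 0\<close> \<Delta>(1,2) by (auto simp: e_def elim!: F3_cases)
  \<comment> \<open>The sign of a form of discriminant \<open>- e\<close>, which is what both forms
    have when neither is degenerate. Discriminant \<open>e\<close> gives the opposite sign.\<close>
  define \<epsilon> where "\<epsilon> = sg (- e)"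
  have \<epsilon>: "\<epsilon> = 1 \<or> \<epsilon> = - 1" by (simp add: \<epsilon>_def sg_def)
  have sg_e: "sg e = - \<epsilon>" using e neg_one_ne_one by (auto simp: \<epsilon>_def sg_def)
  have "\<exists>w. walsh n (coulter_matthews n k a) b = \<epsilon> * G ^ n * w \<and> (w \<in> {1, \<omega>, \<omega>\<^sup>2} \<or> cmod w > 1)" for b
  proof -
    let ?M = "qmat a b" and ?N = "qmat (a * g ^ d) (b * g)"
    let ?T = "\<lambda>M. \<Sum>x\<in>UNIV. chi (form M x x)"
    let ?h = "\<lambda>x. chi (coulter_matthews n k a x - Tr n (b * x))"
    have sq: "(y\<^sup>2) ^ d = y ^ (3 ^ k + 1)" for y :: 'a
      by (simp only: two_d flip: power_mult)
    have "?h (y\<^sup>2) = chi (form ?M y y)" for y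
      by (simp only: coulter_matthews_def form_qmat_diag Tr_diff sq flip: d_def)
    moreover have "?h (g * y\<^sup>2) = chi (form ?N y y)" for y
      by (simp only: coulter_matthews_def form_qmat_diag Tr_diff sq power_mult_distrib mult.assoc
          flip: d_def)
    ultimately have W: "2 * walsh n (coulter_matthews n k a) b = ?T ?M + ?T ?N"
      unfolding walsh_def by (simp add: sum_over_squares[OF g])
    have sum: "\<Delta> * det ?M + \<Delta> * det ?N = e"
      using det_qmat_sum[OF g \<open>odd k\<close>, of a b] by (simp add: e_def flip: distrib_left)
    obtain r \<delta> where M: "\<Delta> * det ?M \<in> F3" "?T ?M = \<delta> * G ^ (n + r)" "\<delta> = 1 \<or> \<delta> = - 1"
      "if det ?M = 0 then r \<ge> 1 else r = 0 \<and> \<delta> = sg (\<Delta> * det ?M)"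
      using quadratic_gauss_sum[OF qmat_carrier qmat_transpose form_qmat_F3, of a b] by blast
    obtain r' \<delta>' where N: "\<Delta> * det ?N \<in> F3" "?T ?N = \<delta>' * G ^ (n + r')" "\<delta>' = 1 \<or> \<delta>' = - 1"
      "if det ?N = 0 then r' \<ge> 1 else r' = 0 \<and> \<delta>' = sg (\<Delta> * det ?N)"
      using quadratic_gauss_sum[OF qmat_carrier qmat_transpose form_qmat_F3, of "a * g ^ d" "b * g"]
      by blast
    \<comment> \<open>One form is degenerate; the other has discriminant \<open>e\<close> and
      contributes \<open>- \<epsilon> * G ^ n\<close>.\<close>
    have mixed: ?thesis if "2 * walsh n (coulter_matthews n k a) b = \<delta> * G ^ (n + r) + - \<epsilon> * G ^ n"
      "r \<ge> 1" "\<delta> = 1 \<or> \<delta> = - 1" for \<delta> r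
    proof -
      have "\<epsilon> * \<delta> = 1 \<or> \<epsilon> * \<delta> = - 1" using \<epsilon> that(3) by auto
      moreover have "walsh n (coulter_matthews n k a) b = \<epsilon> * G ^ n * ((- 1 + (\<epsilon> * \<delta>) * G ^ r) / 2)"
        using \<epsilon> that(1) by (auto simp: power_add field_simps)
      ultimately show ?thesis using G_power_value[OF that(2)] by blast
    qed
    consider "det ?M = 0" | "det ?M \<noteq> 0" "det ?N = 0" | "det ?M \<noteq> 0" "det ?N \<noteq> 0" by blast
    then show ?thesis
    proof cases
      case 1
      then have "\<Delta> * det ?N = e" using sum by simp
      moreover from this have "det ?N \<noteq> 0" using e by auto
      ultimately have "?T ?N = - \<epsilon> * G ^ n" using N sg_e by simp
      then show ?thesis using mixed[of \<delta> r] W M 1 by simp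
    next
      case 2
      then have "\<Delta> * det ?M = e" using sum by simp
      then have "?T ?M = - \<epsilon> * G ^ n" using M 2 sg_e by simp
      then show ?thesis using mixed[of \<delta>' r'] W N 2 by simp
    next
      case 3
      then have "\<Delta> * det ?M \<noteq> 0" "\<Delta> * det ?N \<noteq> 0" using \<Delta>(2) by auto
      \<comment> \<open>Two nonzero elements of \<open>F3\<close> with nonzero sum \<open>e\<close>
        are equal, and \<open>2 * x = e\<close> means \<open>x = - e\<close>.\<close>
      then have "\<Delta> * det ?M = - e" "\<Delta> * det ?N = - e"
        using M(1) N(1) sum e neg_one_ne_one by (auto elim!: F3_cases)
      then have "?T ?M = \<epsilon> * G ^ n" "?T ?N = \<epsilon> * G ^ n" using M N 3 by (simp_all add: \<epsilon>_def)
      then show ?thesis using W by (intro exI[of _ 1]) simp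
    qed
  qed
  with \<epsilon> show thesis by (rule that)
qed

section \<open>Parseval's identity and the conclusion\<close>

lemma parseval:
  fixes f :: "'a \<Rightarrow> 'a"
  assumes "\<And>x. f x \<in> F3"
  shows "(\<Sum>b\<in>UNIV. (cmod (walsh n f b))\<^sup>2) = 3 ^ n * 3 ^ n"
proof -
  have "complex_of_real (\<Sum>b\<in>UNIV. (cmod (walsh n f b))\<^sup>2) = (\<Sum>b\<in>UNIV. walsh n f b * cnj (walsh n f b))"
    by (simp only: of_real_sum complex_norm_square)
  also have "\<dots> = (\<Sum>b\<in>UNIV. \<Sum>x\<in>UNIV. \<Sum>y\<in>UNIV. chi (f x - f y) * chi (Tr n ((y - x) * b)))"
  proof (intro sum.cong refl)
    fix b
    have "chi (f x - Tr n (b * x)) * cnj (chi (f y - Tr n (b * y))) =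
        chi (f x - f y) * chi (Tr n ((y - x) * b))" for x y
    proof -
      have "chi (f x - Tr n (b * x)) * cnj (chi (f y - Tr n (b * y))) =
          chi ((f x - f y) + (Tr n (b * y) - Tr n (b * x)))"
        by (simp add: algebra_simps F3_diff assms Tr_F3 flip: chi_diff)
      also have "Tr n (b * y) - Tr n (b * x) = Tr n ((y - x) * b)"
        by (simp add: algebra_simps flip: Tr_diff)
      also have "chi ((f x - f y) + Tr n ((y - x) * b)) = chi (f x - f y) * chi (Tr n ((y - x) * b))"
        by (simp add: chi_add F3_diff assms Tr_F3)
      finally show ?thesis .
    qed
    then show "walsh n f b * cnj (walsh n f b) =
        (\<Sum>x\<in>UNIV. \<Sum>y\<in>UNIV. chi (f x - f y) * chi (Tr n ((y - x) * b)))"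
      by (simp add: walsh_def sum_product)
  qed
  also have "\<dots> = (\<Sum>x\<in>UNIV. \<Sum>y\<in>UNIV. \<Sum>b\<in>UNIV. chi (f x - f y) * chi (Tr n ((y - x) * b)))"
    by (rule trans[OF sum.swap]) (intro sum.cong refl sum.swap)
  \<comment> \<open>By orthogonality of characters the sum over \<open>b\<close> vanishes unless
    \<open>x = y\<close>.\<close>
  also have "\<dots> = (\<Sum>x\<in>UNIV. \<Sum>y\<in>(UNIV :: 'a set). if y = x then 3 ^ n else 0)"
    by (intro sum.cong refl) (simp add: sum_chi_Tr flip: sum_distrib_left)
  also have "\<dots> = of_real (3 ^ n * 3 ^ n)" by (simp add: card_eq)
  finally show ?thesis by (simp only: of_real_eq_iff)
qed

lemma coulter_matthews_F3: "coulter_matthews n k a (x :: 'a) \<in> F3"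
  by (simp add: coulter_matthews_def Tr_F3)

lemma norm_G_power: "cmod (G ^ n) = sqrt 3 ^ n"
  by (simp add: norm_power G_def norm_mult)

lemma coulter_matthews_weakly_regular_bent:
  fixes a :: 'a
  assumes "odd k" and "a \<noteq> 0"
  shows "bent n (coulter_matthews n k a)" "weakly_regular_bent n (coulter_matthews n k a)"
proof -
  let ?f = "coulter_matthews n k a"
  obtain \<epsilon> where \<epsilon>: "\<epsilon> = 1 \<or> \<epsilon> = - 1"
    "\<And>b. \<exists>w. walsh n ?f b = \<epsilon> * G ^ n * w \<and> (w \<in> {1, \<omega>, \<omega>\<^sup>2} \<or> cmod w > 1)"
    using walsh_value[OF assms] by blast
  then obtain w where w: "\<And>b. walsh n ?f b = \<epsilon> * G ^ n * w b"
    "\<And>b. w b \<in> {1, \<omega>, \<omega>\<^sup>2} \<or> cmod (w b) > 1" by metis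
  define Z where "Z = \<epsilon> * G ^ n"
  have Z: "cmod Z = sqrt 3 ^ n" using \<epsilon>(1) by (auto simp: Z_def norm_mult norm_G_power)
  have "sqrt 3 ^ n * sqrt 3 ^ n = (3 :: real) ^ n"
    by (simp flip: power_mult_distrib)
  then have norm: "(cmod (walsh n ?f b))\<^sup>2 = 3 ^ n * (cmod (w b))\<^sup>2" for b
    by (simp add: w(1) norm_mult power_mult_distrib power2_eq_square Z flip: Z_def)
  have w_ge: "cmod (w b) \<ge> 1" for b
    using w(2)[of b] norm_omega by (auto simp: norm_power)
  have "(\<Sum>b\<in>UNIV. (cmod (walsh n ?f b))\<^sup>2) = 3 ^ n * 3 ^ n"
    by (rule parseval[OF coulter_matthews_F3])
  then have "3 ^ n * (\<Sum>b\<in>UNIV. (cmod (w b))\<^sup>2) = 3 ^ n * (3 ^ n :: real)"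
    by (simp only: norm sum_distrib_left)
  then have sum_w: "(\<Sum>b\<in>UNIV. (cmod (w b))\<^sup>2) = (\<Sum>b\<in>(UNIV :: 'a set). 1)"
    by (simp add: card_eq)
  \<comment> \<open>The squared moduli are at least 1 and add up to the number of field
    elements.\<close>
  have w_sq: "(cmod (w b))\<^sup>2 = 1" for b
    using sum_mono_inv[OF sum_w[symmetric], of b] w_ge by simp
  have w1: "cmod (w b) = 1" for b
    using w_sq[of b] w_ge[of b] by (auto simp: power2_eq_1_iff)
  then show bent: "bent n ?f" by (simp add: bent_def coulter_matthews_F3 norm)
  define f' :: "'a \<Rightarrow> 'a" where "f' b = (if w b = 1 then 0 else if w b = \<omega> then 1 else - 1)" for b
  have f': "f' b \<in> F3" "omega_pow (f' b) = w b" for b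
    using w(2)[of b] w1[of b] by (auto simp: f'_def chi_1 chi_neg_1)
  define c where "c = 3 powr (- real n / 2)"
  have "sqrt 3 ^ n = 3 powr (real n / 2)"
    by (simp add: powr_half_sqrt[symmetric] powr_powr flip: powr_realpow)
  then have c: "c * sqrt 3 ^ n = 1" by (simp add: c_def flip: powr_add)
  have "c > 0" by (simp add: c_def)
  \<comment> \<open>Up to the scaling by \<open>c\<close> this is the inverse of the common factor
    \<open>Z\<close>, whose modulus is the inverse of \<open>c\<close>.\<close>
  define u where "u = of_real c * cnj Z"
  have "cmod u = 1" using c \<open>c > 0\<close> by (simp add: u_def norm_mult Z)
  moreover have "u * of_real c * walsh n ?f b = omega_pow (f' b)" for b
  proof -
    have "u * of_real c * walsh n ?f b = of_real c * of_real c * (Z * cnj Z) * w b"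
      by (simp add: u_def w(1) Z_def mult_ac)
    also have "Z * cnj Z = of_real ((sqrt 3 ^ n)\<^sup>2)"
      using complex_norm_square[of Z] by (simp only: Z)
    also have "of_real c * of_real c * complex_of_real ((sqrt 3 ^ n)\<^sup>2) = of_real ((c * sqrt 3 ^ n)\<^sup>2)"
      by (simp add: power2_eq_square)
    finally show ?thesis by (simp add: c f')
  qed
  ultimately show "weakly_regular_bent n ?f"
    unfolding weakly_regular_bent_def using bent f'(1) by (fold c_def) blast
qed

text \<open>The power map is injective: \<open>z ^ d = 1\<close> makes \<open>z ^ (3 ^ k)\<close>
  the inverse of \<open>z\<close>, so \<open>z\<close> is fixed by the \<open>2 * k\<close>-th power
  of Frobenius. As \<open>2 * k\<close> is prime to \<open>n\<close>, \<open>z\<close> lies in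
  \<open>F3\<close>, where odd \<open>d\<close> leaves only 1. The Walsh coefficient at 0 is then a
  nontrivial character sum.\<close>

lemma coulter_matthews_not_bent:
  fixes a :: 'a
  assumes "even k" and "a \<noteq> 0"
  shows "\<not> bent n (coulter_matthews n k a)"
proof -
  obtain j where j: "k = 2 * j" using assms by auto
  have "odd n" using coprime assms(1) by (metis gcd_greatest odd_one)
  have "coprime 2 n" using \<open>odd n\<close> by (simp only: coprime_left_2_iff_odd not_False_eq_True)
  moreover have "coprime k n" by (simp only: coprime_iff_gcd_eq_1 coprime)
  ultimately have "coprime (2 * k) n" by (simp only: coprime_mult_left_iff simp_thms)
  have "odd d"
  proof -
    \<comment> \<open>A power of 9; hence \<open>2 * d\<close> is 2 modulo 4.\<close>
    have "(3 :: nat) ^ k mod 4 = 1"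
      unfolding j power_mult by (simp add: power_mod[of 9, symmetric])
    then show ?thesis using two_d by presburger
  qed
  have inj: "inj (\<lambda>x :: 'a. x ^ d)"
  proof (rule injI)
    fix x y :: 'a assume eq: "x ^ d = y ^ d"
    have "d > 0" using two_d by (cases d) auto
    show "x = y"
    proof (cases "y = 0")
      case True
      then show ?thesis using eq \<open>d > 0\<close> by (simp add: zero_power)
    next
      case False
      define z where "z = x / y"
      have zd: "z ^ d = 1" using eq False by (simp add: z_def power_divide)
      then have "z * z ^ (3 ^ k) = 1"
        using power_mult[of z d 2] by (simp add: mult.commute[of d] two_d)
      then have inv: "z ^ (3 ^ k) = inverse z" by (metis inverse_unique)
      have "z ^ (3 ^ (2 * k)) = (z ^ (3 ^ k)) ^ (3 ^ k)"
        by (simp add: mult_2 power_add flip: power_mult)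
      also have "\<dots> = z" by (simp add: inv power_inverse)
      finally have "z \<in> F3"
        using \<open>coprime (2 * k) n\<close> by (intro pow3_fixed_imp_F3[of "2 * k"])
          (simp_all only: coprime_iff_gcd_eq_1)
      then have "z = 1" using zd \<open>odd d\<close> \<open>d > 0\<close> neg_one_ne_one
        by (auto elim!: F3_cases simp: zero_power)
      then show ?thesis using False by (simp add: z_def)
    qed
  qed
  then have "bij (\<lambda>x :: 'a. x ^ d)" by (simp add: bij_def finite_UNIV_inj_surj)
  then have "walsh n (coulter_matthews n k a) 0 = (\<Sum>x\<in>UNIV. chi (Tr n (a * x)))"
    unfolding walsh_def coulter_matthews_def d_def[symmetric]
    by (simp add: sum.reindex_bij_betw[of "\<lambda>x. x ^ d" UNIV UNIV "\<lambda>x. chi (Tr n (a * x))"])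
  also have "\<dots> = 0" using assms by (simp add: sum_chi_Tr)
  finally show ?thesis by (auto simp: bent_def intro!: exI[of _ 0])
qed

end

theorem theorem1p2:
  fixes n k :: nat and a :: "'a :: {field, finite}"
  assumes "n \<ge> 1" and "k \<ge> 1"
    and "CARD('a) = 3 ^ n"
    and "gcd k n = 1"
    and "a \<noteq> 0"
  shows "(odd k \<longrightarrow> bent n (coulter_matthews n k a)) \<and>
    (bent n (coulter_matthews n k a) \<longrightarrow> weakly_regular_bent n (coulter_matthews n k a))"
proof -
  interpret ternary_field n k "TYPE('a)"
    using assms by unfold_locales auto
  \<comment> \<open>For even \<open>k\<close> the premise of the second implication fails.\<close>
  show ?thesis
    using coulter_matthews_weakly_regular_bent[of a] coulter_matthews_not_bent[of a] assms by blast
qed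

end
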